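(* Let $s\ge 2$ be an integer, $m_s=\lceil\log_2(s+2)\rceil$ and $m^*_s=\min\{m: s\le\binom{m}{\lceil m/2\rceil}\}$. (i) If $s\in[2^{m_s-1}-1,\,2^{m_s}-\binom{m_s}{\lceil m_s/2\rceil}-1]$, then for any $\varepsilon>0$ there exists $\delta>0$ such that every $\mathcal F\subseteq 2^{[n]}$ with $|\mathcal F|\ge (m_s+\varepsilon)\binom{n}{\lfloor n/2\rfloor}$ contains at least $\delta n^{m_s-0.5}\binom{n}{\lfloor n/2\rfloor}$ copies of $D_s$. (ii) For any $\varepsilon>0$ there exists $\delta>0$ such that every $\mathcal F\subseteq 2^{[n]}$ with $|\mathcal F|\ge(4+\varepsilon)\binom{n}{\lfloor n/2\rfloor}$ contains at least $\delta n^{3.5}\binom{n}{\lfloor n/2\rfloor}$ induced copies of $D_4$. (iii) For any constant $c$ with $1/2<c<1$ there exists an integer $s_c$ such that if $s\ge s_c$ and $s\le c\binom{m^*_s}{\lfloor m^*_s/2\rfloor}$, then for any $\varepsilon>0$ there exists $\delta>0$ such that every $\mathcal F\subseteq 2^{[n]}$ with $|\mathcal F|\ge(m^*_s+\varepsilon)\binom{n}{\lfloor n/2\rfloor}$ contains at least $\delta n^{m^*_s-0.5}\binom{n}{\lfloor n/2\rfloor}$ induced copies of $D_s$.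
   Context: The generalized diamond $D_s$ is the poset on $s+2$ elements $a,b_1,\dots,b_s,c$ with $a<b_1,\dots,b_s<c$ and the $b_i$ pairwise incomparable. For a finite poset $P$ and $\mathcal F\subseteq 2^{[n]}$, a copy of $P$ in $\mathcal F$ is a subfamily $\mathcal G\subseteq\mathcal F$ with a bijection $i:P\to\mathcal G$ such that $p\le q$ implies $i(p)\subseteq i(q)$; it is an induced copy if moreover $p\le q$ if and only if $i(p)\subseteq i(q)$. *)

theory Defs
  imports Complex_Main
begin

text \<open>A finite poset is given by its carrier \<open>P\<close> together with its order
  \<open>r\<close>, a relation with \<open>partial_order_on P r\<close>.  A copy is the subfamily itself, not the
  pair consisting of the subfamily and the bijection, so each subfamily is counted once.\<close>

definition copies :: "'p set \<Rightarrow> 'p rel \<Rightarrow> 'a set set \<Rightarrow> 'a set set set" where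
  "copies P r F =
     {G. G \<subseteq> F \<and> (\<exists>i. bij_betw i P G \<and> (\<forall>p\<in>P. \<forall>q\<in>P. (p, q) \<in> r \<longrightarrow> i p \<subseteq> i q))}"

definition induced_copies :: "'p set \<Rightarrow> 'p rel \<Rightarrow> 'a set set \<Rightarrow> 'a set set set" where
  "induced_copies P r F =
     {G. G \<subseteq> F \<and> (\<exists>i. bij_betw i P G \<and> (\<forall>p\<in>P. \<forall>q\<in>P. (p, q) \<in> r \<longleftrightarrow> i p \<subseteq> i q))}"

datatype diamond_elem = Bottom | Middle nat | Top

definition diamond :: "nat \<Rightarrow> diamond_elem set" where
  "diamond s = {Bottom, Top} \<union> Middle ` {1..s}"

definition diamond_order :: "nat \<Rightarrow> diamond_elem rel" where
  "diamond_order s = {(p, q). p \<in> diamond s \<and> q \<in> diamond s \<and> (p = q \<or> p = Bottom \<or> q = Top)}"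

lemma partial_order_diamond: "partial_order_on (diamond s) (diamond_order s)"
  by (auto simp: diamond_order_def diamond_def partial_order_on_def preorder_on_def
      refl_on_def trans_def antisym_def)

lemma card_diamond: "card (diamond s) = s + 2"
proof -
  have "card (Middle ` {1..s}) = s"
    by (simp add: card_image inj_on_def)
  then show ?thesis
    unfolding diamond_def by (subst card_Un_disjoint) auto
qed

definition m_diamond :: "nat \<Rightarrow> nat" where
  "m_diamond s = nat \<lceil>log 2 (real s + 2)\<rceil>"

text \<open>Here and in the theorem, \<open>(m + 1) div 2\<close> is $\lceil m/2\rceil$ and
  \<open>m div 2\<close> is $\lfloor m/2\rfloor$.\<close>

definition m_star :: "nat \<Rightarrow> nat" where
  "m_star s = (LEAST m. s \<le> m choose ((m + 1) div 2))"

end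

theory Submission
  imports Defs "HOL-Real_Asymp.Real_Asymp"
begin

text \<open>
  Call a pair \<open>A \<subseteq> B\<close> of members of \<open>F\<close> good if a uniformly random maximal chain from \<open>A\<close> to
  \<open>B\<close> meets \<open>F\<close> in more than \<open>m\<close> sets on average.  A random full chain meets \<open>F\<close> in at least
  \<open>m + \<epsilon>\<close> sets on average, and following it greedily shows that it contains at least \<open>\<epsilon>\<close> good
  pairs on average.  After the levels of size below \<open>\<eta> (n choose n div 2) / sqrt n\<close> have been
  discarded, which costs only \<open>O(\<eta>) (n choose n div 2)\<close> sets, a good pair lies on a random chain
  with probability \<open>O(n powr (1/2 - m) / (n choose n div 2))\<close>, since good pairs are at least \<open>m\<close>
  levels apart.  Hence there are many good pairs.  Each is the bottom and top of its own diamond: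
  an interval with few members of \<open>F\<close> inside, respectively with no large antichain of \<open>F\<close> in a
  level, has average at most \<open>m\<close>.
\<close>

section \<open>Lubell sums over intervals\<close>

text \<open>The expected total \<open>f\<close>-weight on a uniformly random maximal chain from \<open>A\<close> to \<open>B\<close>.\<close>

definition lubell :: "('a set \<Rightarrow> real) \<Rightarrow> 'a set \<Rightarrow> 'a set \<Rightarrow> real" where
  "lubell f A B = (\<Sum>S\<in>{A..B}. f S / real (card (B - A) choose card (S - A)))"

lemma finite_set_interval: "finite B \<Longrightarrow> finite {A..B::'a set}"
  by (rule finite_subset[of _ "Pow B"]) auto

lemma lubell_self: "lubell f A A = f A"
  by (simp add: lubell_def)

lemma lubell_nonneg:
  assumes "\<And>S. A \<subseteq> S \<Longrightarrow> S \<subseteq> B \<Longrightarrow> 0 \<le> f S"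
  shows "0 \<le> lubell f A B"
  unfolding lubell_def by (intro sum_nonneg divide_nonneg_nonneg) (auto intro: assms)

text \<open>Every chain from \<open>A\<close> to \<open>B\<close> ends in \<open>B\<close>, so
  \<open>f B\<close> is always collected.\<close>

lemma lubell_ge_top:
  assumes "\<And>S. A \<subseteq> S \<Longrightarrow> S \<subseteq> B \<Longrightarrow> 0 \<le> f S" "finite B" "A \<subseteq> B"
  shows "f B \<le> lubell f A B"
proof -
  have "f B / real (card (B - A) choose card (B - A)) \<le> lubell f A B"
    unfolding lubell_def using assms
    by (intro member_le_sum) (auto simp: finite_set_interval)
  then show ?thesis by simp
qed

section \<open>Recursions at the two ends of an interval\<close>

text \<open>Serves both recursions below: of the \<open>k\<close> possible steps, \<open>j\<close>
  are compatible with a given set, and an absorption identity supplies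
  \<open>k * q = j * p\<close>.\<close>

lemma weight_transfer:
  fixes p q j k x :: real
  assumes "k * q = j * p" "0 < k" "0 < q"
  shows "j * (x / q) / k = x / p"
proof -
  have "j \<noteq> 0" using assms by auto
  have "j * (x / q) / k = j * x / (k * q)" by simp
  then show ?thesis using assms(1) \<open>j \<noteq> 0\<close> by simp
qed

text \<open>A random maximal chain makes a uniformly random first step to some
  \<open>insert a A\<close>. In the double sum a set \<open>S\<close> other than \<open>A\<close>
  occurs once for each \<open>a\<close> in \<open>S - A\<close>, and absorption restores its
  weight.\<close>

lemma lubell_bottom_rec:
  assumes "finite B" "A \<subset> B"
  shows "lubell f A B = f A + (\<Sum>a\<in>B - A. lubell f (insert a A) B) / real (card (B - A))"
proof -
  define k where "k = card (B - A)"
  have k0: "k > 0" using assms by (auto simp: k_def card_gt_0_iff)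
  have cB: "card (B - insert a A) = k - 1" if "a \<in> B - A" for a
    using that unfolding k_def by (subst Diff_insert) (rule card_Diff_singleton, simp)
  have cS: "card (S - insert a A) = card (S - A) - 1" if "a \<in> S - A" for S a
    using that by (subst Diff_insert) (rule card_Diff_singleton, simp)
  have fI: "finite {A..B}" using assms(1) by (rule finite_set_interval)
  have absorb: "real (card (S - A)) * (f S / real ((k - 1) choose (card (S - A) - 1))) / real k
      = f S / real (k choose card (S - A))" if S: "S \<in> {A..B} - {A}" for S
  proof -
    define j where "j = card (S - A)"
    have fS: "finite S" using S assms(1) finite_subset by auto
    have j0: "j > 0" using S fS by (auto simp: j_def card_gt_0_iff)
    have jk: "j \<le> k" using S assms(1) unfolding j_def k_def by (intro card_mono) auto
    have "real k * real ((k - 1) choose (j - 1)) = real j * real (k choose j)"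
      using times_binomial_minus1_eq[OF j0, of k] by (metis of_nat_mult)
    then show ?thesis unfolding j_def[symmetric]
      using k0 jk j0 by (intro weight_transfer) auto
  qed
  have "(\<Sum>a\<in>B - A. lubell f (insert a A) B)
      = (\<Sum>a\<in>B - A. \<Sum>S\<in>{A..B}. if a \<in> S then f S / real ((k - 1) choose (card (S - A) - 1)) else 0)"
  proof (rule sum.cong)
    fix a assume a: "a \<in> B - A"
    have "lubell f (insert a A) B = (\<Sum>S\<in>{S\<in>{A..B}. a \<in> S}. f S / real ((k - 1) choose (card (S - A) - 1)))"
      unfolding lubell_def using a by (intro sum.cong) (auto simp: cB cS k_def)
    then show "lubell f (insert a A) B = (\<Sum>S\<in>{A..B}. if a \<in> S then f S / real ((k - 1) choose (card (S - A) - 1)) else 0)"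
      by (simp only: sum.inter_filter[OF fI])
  qed simp
  also have "\<dots> = (\<Sum>S\<in>{A..B}. \<Sum>a\<in>B - A. if a \<in> S then f S / real ((k - 1) choose (card (S - A) - 1)) else 0)"
    by (rule sum.swap)
  also have "\<dots> = (\<Sum>S\<in>{A..B}. real (card (S - A)) * (f S / real ((k - 1) choose (card (S - A) - 1))))"
  proof (rule sum.cong)
    fix S assume S: "S \<in> {A..B}"
    have "{a \<in> B - A. a \<in> S} = S - A" using S by auto
    then show "(\<Sum>a\<in>B - A. if a \<in> S then f S / real ((k - 1) choose (card (S - A) - 1)) else 0)
       = real (card (S - A)) * (f S / real ((k - 1) choose (card (S - A) - 1)))"
      using assms(1) by (simp flip: sum.inter_filter)
  qed simp
  \<comment> \<open>The term of \<open>A\<close> vanishes because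
    \<open>card (A - A) = 0\<close>.\<close>
  also have "\<dots> = (\<Sum>S\<in>{A..B} - {A}. real (card (S - A)) * (f S / real ((k - 1) choose (card (S - A) - 1))))"
    using fI assms(2) by (intro sum.mono_neutral_right) auto
  finally have "(\<Sum>a\<in>B - A. lubell f (insert a A) B) / real k
      = (\<Sum>S\<in>{A..B} - {A}. f S / real (k choose card (S - A)))"
    by (simp only: sum_divide_distrib) (intro sum.cong refl absorb)
  moreover have "lubell f A B = f A + (\<Sum>S\<in>{A..B} - {A}. f S / real (k choose card (S - A)))"
    unfolding lubell_def k_def using assms fI by (subst sum.remove[of _ A]) auto
  ultimately show ?thesis by (simp add: k_def)
qed

text \<open>The mirror image: the last step comes from a uniformly random \<open>B - {a}\<close>,
  and a set \<open>S\<close> other than \<open>B\<close> lies below \<open>card (B - S)\<close> of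
  these.\<close>

lemma lubell_top_rec:
  assumes "finite B" "A \<subset> B"
  shows "lubell f A B = f B + (\<Sum>a\<in>B - A. lubell f A (B - {a})) / real (card (B - A))"
proof -
  define k where "k = card (B - A)"
  have k0: "k > 0" using assms by (auto simp: k_def card_gt_0_iff)
  have cB: "card (B - {a} - A) = k - 1" if "a \<in> B - A" for a
  proof -
    have "B - {a} - A = B - A - {a}" by auto
    then show ?thesis using that unfolding k_def by (metis card_Diff_singleton)
  qed
  have fI: "finite {A..B}" using assms(1) by (rule finite_set_interval)
  have absorb: "real (card (B - S)) * (f S / real ((k - 1) choose card (S - A))) / real k
      = f S / real (k choose card (S - A))" if S: "S \<in> {A..B} - {B}" for S
  proof -
    define j where "j = card (S - A)"
    have fS: "finite S" using S assms(1) finite_subset by auto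
    have jk: "j < k" using S assms(1) unfolding j_def k_def by (intro psubset_card_mono) auto
    have "B - S = (B - A) - (S - A)" using S by auto
    then have c: "card (B - S) = k - j"
      using S fS by (simp add: card_Diff_subset k_def j_def Diff_mono)
    have "(k - j) * (k choose j) = k * ((k - 1) choose j)"
      by (rule binomial_absorb_comp)
    then have "real k * real ((k - 1) choose j) = real (k - j) * real (k choose j)"
      by (metis of_nat_mult)
    then show ?thesis unfolding j_def[symmetric] c
      using k0 jk by (intro weight_transfer) auto
  qed
  have "(\<Sum>a\<in>B - A. lubell f A (B - {a}))
      = (\<Sum>a\<in>B - A. \<Sum>S\<in>{A..B}. if a \<notin> S then f S / real ((k - 1) choose card (S - A)) else 0)"
  proof (rule sum.cong)
    fix a assume a: "a \<in> B - A"
    have "lubell f A (B - {a}) = (\<Sum>S\<in>{S\<in>{A..B}. a \<notin> S}. f S / real ((k - 1) choose card (S - A)))"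
      unfolding lubell_def using a by (intro sum.cong) (auto simp: cB)
    then show "lubell f A (B - {a}) = (\<Sum>S\<in>{A..B}. if a \<notin> S then f S / real ((k - 1) choose card (S - A)) else 0)"
      by (simp only: sum.inter_filter[OF fI])
  qed simp
  also have "\<dots> = (\<Sum>S\<in>{A..B}. \<Sum>a\<in>B - A. if a \<notin> S then f S / real ((k - 1) choose card (S - A)) else 0)"
    by (rule sum.swap)
  also have "\<dots> = (\<Sum>S\<in>{A..B}. real (card (B - S)) * (f S / real ((k - 1) choose card (S - A))))"
  proof (rule sum.cong)
    fix S assume S: "S \<in> {A..B}"
    have "{a \<in> B - A. a \<notin> S} = B - S" using S by auto
    then show "(\<Sum>a\<in>B - A. if a \<notin> S then f S / real ((k - 1) choose card (S - A)) else 0)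
       = real (card (B - S)) * (f S / real ((k - 1) choose card (S - A)))"
      using sum.inter_filter[of "B - A" "\<lambda>_. f S / real ((k - 1) choose card (S - A))" "\<lambda>a. a \<notin> S"] assms(1)
      by simp
  qed simp
  also have "\<dots> = (\<Sum>S\<in>{A..B} - {B}. real (card (B - S)) * (f S / real ((k - 1) choose card (S - A))))"
    using fI assms(2) by (intro sum.mono_neutral_right) auto
  finally have "(\<Sum>a\<in>B - A. lubell f A (B - {a})) / real k
      = (\<Sum>S\<in>{A..B} - {B}. f S / real (k choose card (S - A)))"
    by (simp only: sum_divide_distrib) (intro sum.cong refl absorb)
  moreover have "lubell f A B = f B + (\<Sum>S\<in>{A..B} - {B}. f S / real (k choose card (S - A)))"
    unfolding lubell_def k_def using assms fI by (subst sum.remove[of _ B]) auto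
  ultimately show ?thesis by (simp add: k_def)
qed

text \<open>Walk up the random chain until it meets the first member \<open>S\<close> of \<open>F\<close> for which the interval from
  \<open>S\<close> to \<open>B\<close> has average at most \<open>m\<close>; every member met before is counted on the right.\<close>

lemma lubell_le_good_below:
  assumes "finite B" "A \<subseteq> B" "1 \<le> m"
  shows "lubell (\<lambda>S. of_bool (S \<in> F)) A B
     \<le> m + lubell (\<lambda>S. of_bool (S \<in> F \<and> m < lubell (\<lambda>S. of_bool (S \<in> F)) S B)) A B"
  using assms(2)
proof (induction "card (B - A)" arbitrary: A)
  case 0
  then have "A = B" using assms(1) by auto
  then show ?case using assms(3) by (auto simp: lubell_self)
next
  case (Suc k)
  let ?L = "\<lambda>A. lubell (\<lambda>S. of_bool (S \<in> F)) A B"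
  let ?G = "\<lambda>A. lubell (\<lambda>S. of_bool (S \<in> F \<and> m < ?L S)) A B"
  show ?case
  proof (cases "?L A \<le> m")
    case True
    moreover have "0 \<le> ?G A" by (rule lubell_nonneg) auto
    ultimately show ?thesis by linarith
  next
    case False
    have AB: "A \<subset> B" using Suc by auto
    have "?L A = of_bool (A \<in> F) + (\<Sum>a\<in>B - A. ?L (insert a A)) / real (card (B - A))"
      by (rule lubell_bottom_rec) (use assms AB in auto)
    also have "(\<Sum>a\<in>B - A. ?L (insert a A)) \<le> (\<Sum>a\<in>B - A. m + ?G (insert a A))"
    proof (rule sum_mono)
      fix a assume a: "a \<in> B - A"
      have "card (B - insert a A) = k" using a Suc(2) by (subst Diff_insert) (simp add: card_Diff_singleton)
      then show "?L (insert a A) \<le> m + ?G (insert a A)" using a Suc(1)[of "insert a A"] Suc(3) by auto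
    qed
    also have "\<dots> = real (card (B - A)) * m + (\<Sum>a\<in>B - A. ?G (insert a A))"
      by (simp add: sum.distrib)
    \<comment> \<open>Here \<open>m < ?L A\<close>, so \<open>A\<close> counts as good exactly when
      it lies in \<open>F\<close>, and the two indicators agree.\<close>
    also have "of_bool (A \<in> F) + \<dots> / real (card (B - A))
       = m + (of_bool (A \<in> F \<and> m < ?L A) + (\<Sum>a\<in>B - A. ?G (insert a A)) / real (card (B - A)))"
      using Suc(2) False by (simp add: field_simps flip: Suc(2))
    also have "of_bool (A \<in> F \<and> m < ?L A) + (\<Sum>a\<in>B - A. ?G (insert a A)) / real (card (B - A)) = ?G A"
      by (rule lubell_bottom_rec[symmetric]) (use assms AB in auto)
    finally show ?thesis by (simp add: divide_right_mono)
  qed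
qed

text \<open>Descend from \<open>U\<close> to the first member \<open>B\<close> of \<open>F\<close>,
  losing nothing on the way, and apply \<open>lubell_le_good_below\<close> beneath it. Pairs with
  other tops only add nonnegative terms.\<close>

lemma lubell_le_good_pairs:
  assumes "finite U" "1 \<le> m"
  shows "lubell (\<lambda>S. of_bool (S \<in> F)) {} U
     \<le> m + lubell (\<lambda>B. of_bool (B \<in> F) *
         lubell (\<lambda>S. of_bool (S \<in> F \<and> m < lubell (\<lambda>S. of_bool (S \<in> F)) S B)) {} B) {} U"
  using assms(1)
proof (induction "card U" arbitrary: U)
  case 0
  then show ?case using assms(2) by (auto simp: lubell_self)
next
  case (Suc k)
  let ?L = "\<lambda>A B. lubell (\<lambda>S. of_bool (S \<in> F)) A B"
  let ?g = "\<lambda>B. of_bool (B \<in> F) * lubell (\<lambda>S. of_bool (S \<in> F \<and> m < ?L S B)) {} B"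
  have g0: "0 \<le> ?g B" for B by (intro mult_nonneg_nonneg lubell_nonneg) auto
  show ?case
  proof (cases "U \<in> F")
    case True
    have "?L {} U \<le> m + ?g U" using lubell_le_good_below[of U "{}" m F] Suc assms True by simp
    also have "?g U \<le> lubell ?g {} U" by (rule lubell_ge_top) (use Suc g0 in auto)
    finally show ?thesis by simp
  next
    case False
    have U: "{} \<subset> U" using Suc by auto
    have "?L {} U = of_bool (U \<in> F) + (\<Sum>a\<in>U - {}. ?L {} (U - {a})) / real (card (U - {}))"
      by (rule lubell_top_rec) (use U Suc in auto)
    also have "\<dots> = (\<Sum>a\<in>U. ?L {} (U - {a})) / real (card U)" using False by simp
    also have "(\<Sum>a\<in>U. ?L {} (U - {a})) \<le> (\<Sum>a\<in>U. m + lubell ?g {} (U - {a}))"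
      using Suc by (intro sum_mono Suc(1)) auto
    also have "\<dots> = real (card U) * m + (\<Sum>a\<in>U. lubell ?g {} (U - {a}))"
      by (simp add: sum.distrib)
    also have "\<dots> / real (card U) = m + (?g U + (\<Sum>a\<in>U - {}. lubell ?g {} (U - {a})) / real (card (U - {})))"
      using Suc(2) False by (simp add: field_simps flip: Suc(2))
    also have "?g U + (\<Sum>a\<in>U - {}. lubell ?g {} (U - {a})) / real (card (U - {})) = lubell ?g {} U"
      by (rule lubell_top_rec[symmetric]) (use U Suc in auto)
    finally show ?thesis by (simp add: divide_right_mono)
  qed
qed

section \<open>Level counts of an interval\<close>

text \<open>Sets on one level share one weight, so later bounds on averages become inequalities
  about numbers \<open>x i \<le> k choose i\<close>.\<close>

lemma lubell_eq_profile:
  assumes "finite B" "A \<subseteq> B"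
  shows "lubell (\<lambda>S. of_bool (S \<in> F)) A B = 
    (\<Sum>i\<le>card (B - A). real (card {S \<in> F. A \<subseteq> S \<and> S \<subseteq> B \<and> card (S - A) = i}) / real (card (B - A) choose i))"
proof -
  let ?k = "card (B - A)"
  have fI: "finite {A..B}" using assms(1) by (rule finite_set_interval)
  have "lubell (\<lambda>S. of_bool (S \<in> F)) A B
     = (\<Sum>i\<le>?k. \<Sum>S\<in>{S\<in>{A..B}. card (S - A) = i}. of_bool (S \<in> F) / real (?k choose card (S - A)))"
    unfolding lubell_def
    by (rule sum.group[symmetric]) (use fI assms in \<open>auto intro!: card_mono\<close>)
  also have "\<dots> = (\<Sum>i\<le>?k. real (card {S \<in> F. A \<subseteq> S \<and> S \<subseteq> B \<and> card (S - A) = i}) / real (?k choose i))"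
  proof (rule sum.cong)
    fix i
    let ?I = "{S\<in>{A..B}. card (S - A) = i}"
    have fi: "finite ?I" by (rule finite_subset[OF _ fI]) auto
    have "(\<Sum>S\<in>?I. of_bool (S \<in> F) / real (?k choose card (S - A))) = (\<Sum>S\<in>?I. of_bool (S \<in> F)) / real (?k choose i)"
      by (simp add: sum_divide_distrib)
    also have "(\<Sum>S\<in>?I. of_bool (S \<in> F)) = real (card (?I \<inter> {S. S \<in> F}))"
      by (rule sum_of_bool_eq) (rule fi)+
    also have "?I \<inter> {S. S \<in> F} = {S \<in> F. A \<subseteq> S \<and> S \<subseteq> B \<and> card (S - A) = i}" by auto
    finally show "(\<Sum>S\<in>?I. of_bool (S \<in> F) / real (?k choose card (S - A)))
       = real (card {S \<in> F. A \<subseteq> S \<and> S \<subseteq> B \<and> card (S - A) = i}) / real (?k choose i)" .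
  qed simp
  finally show ?thesis .
qed

lemma card_interval_level_le:
  assumes "finite B"
  shows "card {S \<in> F. A \<subseteq> S \<and> S \<subseteq> B \<and> card (S - A) = i} \<le> card (B - A) choose i"
proof -
  have "card {S \<in> F. A \<subseteq> S \<and> S \<subseteq> B \<and> card (S - A) = i} \<le> card {T. T \<subseteq> B - A \<and> card T = i}"
  proof (rule card_inj_on_le)
    show "inj_on (\<lambda>S. S - A) {S \<in> F. A \<subseteq> S \<and> S \<subseteq> B \<and> card (S - A) = i}"
      by (intro inj_onI) blast
    show "finite {T. T \<subseteq> B - A \<and> card T = i}"
      by (rule finite_subset[of _ "Pow (B - A)"]) (use assms in auto)
  qed blast
  then show ?thesis using assms by (simp add: n_subsets)
qed

lemma profile_term_le_1: "x \<le> (k choose i) \<Longrightarrow> real x / real (k choose i) \<le> 1"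
  \<comment> \<open>For \<open>i > k\<close> the denominator is \<open>0\<close>, and so is the
    quotient by convention.\<close>
  by (cases "k choose i = 0") (simp_all add: divide_le_eq_1 del: binomial_eq_0_iff)

lemma profile_le_height:
  assumes "\<And>i. x i \<le> k choose i"
  shows "(\<Sum>i\<le>k. real (x i) / real (k choose i)) \<le> real k + 1"
proof -
  have "(\<Sum>i\<le>k. real (x i) / real (k choose i)) \<le> (\<Sum>i\<le>k. 1)"
    by (intro sum_mono profile_term_le_1 assms)
  then show ?thesis by simp
qed

lemma lubell_le_card:
  assumes "finite B" "A \<subseteq> B"
  shows "lubell (\<lambda>S. of_bool (S \<in> F)) A B \<le> real (card (B - A)) + 1"
  unfolding lubell_eq_profile[OF assms]
  using card_interval_level_le[OF assms(1)] by (rule profile_le_height)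

section \<open>Small levels of the Boolean lattice\<close>

text \<open>Read downwards from \<open>a j\<close>, the terms are dominated by a geometric series
  with ratio \<open>1 - r\<close>, whose sum is \<open>a j / r\<close>.\<close>

lemma geometric_partial_sum_le:
  fixes a :: "nat \<Rightarrow> real"
  assumes "0 < r" "a 0 \<ge> 0" "r \<le> 1" "\<And>i. i < j \<Longrightarrow> a i \<le> (1 - r) * a (Suc i)"
  shows "(\<Sum>i\<le>j. a i) \<le> a j / r"
  using assms(4)
proof (induction j)
  case 0
  have "a 0 * r \<le> a 0 * 1" using assms(1-3) by (intro mult_left_mono) auto
  then show ?case using assms(1) by (simp add: field_simps)
next
  case (Suc j)
  have "(\<Sum>i\<le>j. a i) \<le> a j / r" using Suc.prems by (intro Suc.IH) simp
  then have "(\<Sum>i\<le>Suc j. a i) \<le> a j / r + a (Suc j)" by simp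
  also have "\<dots> \<le> (1 - r) * a (Suc j) / r + a (Suc j)"
    using divide_right_mono[OF Suc.prems[of j], of r] assms(1) by simp
  also have "\<dots> = a (Suc j) / r" using assms(1) by (simp add: field_simps)
  finally show ?case .
qed

lemma binomial_step:
  assumes "i < n"
  shows "real (n choose i) * real (n - i) = real (Suc i) * real (n choose Suc i)"
proof -
  have "(n choose i) * (n - i) = Suc i * (n choose Suc i)"
    by (simp only: binomial_absorb_comp binomial_absorption mult.commute[of "n choose i"])
  then have "real ((n choose i) * (n - i)) = real (Suc i * (n choose Suc i))"
    by (rule arg_cong)
  then show ?thesis by (simp only: of_nat_mult)
qed

text \<open>The quotient of the two coefficients is \<open>Suc i / (n - i)\<close>.\<close>

lemma binomial_ratio_le:
  assumes "i < n" "real (Suc i) \<le> q * real (n - i)"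
  shows "real (n choose i) \<le> q * real (n choose Suc i)"
proof -
  have "real (n choose i) * real (n - i) \<le> (q * real (n choose Suc i)) * real (n - i)"
    using binomial_step[OF assms(1)] mult_right_mono[OF assms(2), of "real (n choose Suc i)"]
    by (simp add: mult_ac)
  then show ?thesis using assms(1) by simp
qed

text \<open>Only \<open>O(sqrt n)\<close> levels lie within \<open>sqrt n\<close> of the middle; further down the level sizes decay
  geometrically with ratio \<open>1 - 1 / sqrt n\<close>.\<close>

lemma sum_small_binomials_lower:
  assumes "n \<ge> 2" "\<eta> > 0"
  defines "t \<equiv> \<eta> * real (n choose (n div 2)) / sqrt (real n)"
  shows "(\<Sum>i\<in>{i. 2 * i \<le> n \<and> real (n choose i) < t}. real (n choose i))
       \<le> 4 * \<eta> * real (n choose (n div 2))"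
proof -
  define C where "C = real (n choose (n div 2))"
  define D where "D = {i. 2 * i \<le> n \<and> real (n choose i) < t}"
  \<comment> \<open>\<open>D1\<close> has at most \<open>sqrt n + 1 \<le> 2 * sqrt n\<close> levels,
    each of size below \<open>t\<close>; \<open>D2\<close> collects the levels further down.\<close>
  define D1 where "D1 = {i \<in> D. real i \<ge> n / 2 - sqrt n}"
  define D2 where "D2 = {i \<in> D. real i < n / 2 - sqrt n}"
  have C0: "C > 0" unfolding C_def by simp
  have s1: "sqrt (real n) \<ge> 1" using assms(1) by simp
  have t0: "t \<ge> 0" using assms by simp
  have ts: "t * sqrt n = \<eta> * C" using s1 by (simp add: t_def C_def)
  have fD: "finite D" by (rule finite_subset[of _ "{..n}"]) (auto simp: D_def)
  have "D1 \<subseteq> {nat \<lceil>n / 2 - sqrt n\<rceil>..n div 2}" by (auto simp: D1_def D_def)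
  then have "card D1 \<le> n div 2 + 1 - nat \<lceil>n / 2 - sqrt n\<rceil>"
    using card_mono[of "{nat \<lceil>n / 2 - sqrt n\<rceil>..n div 2}" D1] by simp
  then have "real (card D1) \<le> sqrt n + 1"
    using s1 by linarith
  then have c1: "real (card D1) \<le> 2 * sqrt n" using s1 by linarith
  have "(\<Sum>i\<in>D1. real (n choose i)) \<le> real (card D1) * t"
    by (rule sum_bounded_above) (auto simp: D1_def D_def)
  also have "\<dots> \<le> 2 * sqrt n * t" using c1 t0 by (intro mult_right_mono)
  finally have S1: "(\<Sum>i\<in>D1. real (n choose i)) \<le> 2 * (\<eta> * C)" using ts by (simp add: mult_ac)
  have S2: "(\<Sum>i\<in>D2. real (n choose i)) \<le> \<eta> * C"
  proof (cases "D2 = {}")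
    case True
    then show ?thesis using C0 assms(2) by simp
  next
    case False
    have fD2: "finite D2" using fD by (simp add: D2_def)
    \<comment> \<open>All of \<open>D2\<close> lies at or below \<open>j\<close>, and level
      \<open>j\<close> itself has size below \<open>t\<close>, so the geometric sum up to
      \<open>j\<close> is at most \<open>t * sqrt n = \<eta> * C\<close>.\<close>
    define j where "j = Max D2"
    have j: "j \<in> D2" using False fD2 by (simp add: j_def)
    have "real (n choose i) \<le> (1 - 1 / sqrt n) * real (n choose Suc i)" if "i < j" for i
    proof (rule binomial_ratio_le)
      show "i < n" using that j by (auto simp: D2_def D_def)
      have i1: "real (Suc i) \<le> n / 2 - sqrt n" using that j by (auto simp: D2_def)
      have ss: "sqrt n * sqrt n = n" by simp
      have "n / 2 + sqrt n \<le> real (n - i)" using i1 \<open>i < n\<close> by (simp add: of_nat_diff)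
      then have "(1 - 1 / sqrt n) * (n / 2 + sqrt n) \<le> (1 - 1 / sqrt n) * real (n - i)"
        using s1 by (intro mult_left_mono) auto
      moreover have "(1 - 1 / sqrt n) * (n / 2 + sqrt n) = n / 2 + sqrt n - sqrt n / 2 - 1"
        using s1 ss by (simp add: field_simps)
      ultimately show "real (Suc i) \<le> (1 - 1 / sqrt n) * real (n - i)"
        using i1 s1 by linarith
    qed
    then have "(\<Sum>i\<le>j. real (n choose i)) \<le> real (n choose j) / (1 / sqrt n)"
      using s1 assms(1) by (intro geometric_partial_sum_le) auto
    also have "\<dots> \<le> t * sqrt n" using j s1 by (auto simp: D2_def D_def intro!: mult_right_mono)
    finally have "(\<Sum>i\<le>j. real (n choose i)) \<le> \<eta> * C" using ts by simp
    moreover have "(\<Sum>i\<in>D2. real (n choose i)) \<le> (\<Sum>i\<le>j. real (n choose i))"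
      using fD2 by (intro sum_mono2) (auto simp: j_def)
    ultimately show ?thesis by simp
  qed
  have "D = D1 \<union> D2" "D1 \<inter> D2 = {}" by (auto simp: D1_def D2_def)
  then have "(\<Sum>i\<in>D. real (n choose i)) = (\<Sum>i\<in>D1. real (n choose i)) + (\<Sum>i\<in>D2. real (n choose i))"
    using fD by (metis finite_Un sum.union_disjoint)
  then show ?thesis using S1 S2 C0 assms(2) mult_pos_pos[OF assms(2) C0] unfolding D_def C_def by linarith
qed

text \<open>Reflecting \<open>i\<close> to \<open>n - i\<close> carries the upper half to the lower
  half and doubles the constant.\<close>

lemma sum_small_binomials:
  assumes "n \<ge> 2" "\<eta> > 0"
  defines "t \<equiv> \<eta> * real (n choose (n div 2)) / sqrt (real n)"
  shows "(\<Sum>i\<in>{i. i \<le> n \<and> real (n choose i) < t}. real (n choose i))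
       \<le> 8 * \<eta> * real (n choose (n div 2))"
proof -
  let ?D = "{i. 2 * i \<le> n \<and> real (n choose i) < t}"
  let ?E = "{i. i \<le> n \<and> real (n choose i) < t}"
  have fD: "finite ?D" by (rule finite_subset[of _ "{..n}"]) auto
  have "?E \<subseteq> ?D \<union> (\<lambda>i. n - i) ` ?D"
  proof
    fix i assume i: "i \<in> ?E"
    show "i \<in> ?D \<union> (\<lambda>i. n - i) ` ?D"
    proof (cases "2 * i \<le> n")
      case False
      then have "n - i \<in> ?D" using i binomial_symmetric[of i n] by auto
      then have "n - (n - i) \<in> (\<lambda>i. n - i) ` ?D" by blast
      then show ?thesis using i by auto
    qed (use i in auto)
  qed
  then have "(\<Sum>i\<in>?E. real (n choose i)) \<le> (\<Sum>i\<in>?D \<union> (\<lambda>i. n - i) ` ?D. real (n choose i))"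
    using fD by (intro sum_mono2) auto
  also have "\<dots> \<le> (\<Sum>i\<in>?D. real (n choose i)) + (\<Sum>i\<in>(\<lambda>i. n - i) ` ?D. real (n choose i))"
    using sum.union_inter[OF fD, of "(\<lambda>i. n - i) ` ?D" "\<lambda>i. real (n choose i)"] fD
      sum_nonneg[of "?D \<inter> (\<lambda>i. n - i) ` ?D" "\<lambda>i. real (n choose i)"] by simp
  also have "(\<Sum>i\<in>(\<lambda>i. n - i) ` ?D. real (n choose i)) = (\<Sum>i\<in>?D. real (n choose (n - i)))"
    by (subst sum.reindex) (auto simp: inj_on_def)
  also have "\<dots> = (\<Sum>i\<in>?D. real (n choose i))"
    by (intro sum.cong) (auto simp flip: binomial_symmetric)
  finally show ?thesis using sum_small_binomials_lower[OF assms(1,2)] unfolding t_def by linarith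
qed

text \<open>Up to level \<open>n / 3\<close> the level sizes at least double at each step, so levels
  below \<open>n / 4\<close> are exponentially small. Hence every set surviving the cutoff has size
  at least \<open>n / 4\<close>.\<close>

lemma low_binomials_small:
  assumes "\<eta> > 0"
  shows "\<exists>N. \<forall>n\<ge>N. \<forall>i. real i < real n / 4 \<longrightarrow>
     real (n choose i) < \<eta> * real (n choose (n div 2)) / sqrt (real n)"
proof -
  have "((\<lambda>n::nat. sqrt (real n) * 2 powr (2 - real n / 12)) \<longlongrightarrow> 0) sequentially"
    by real_asymp
  then have "eventually (\<lambda>n. sqrt (real n) * 2 powr (2 - real n / 12) < \<eta>) sequentially"
    using assms by (rule order_tendstoD(2))
  then obtain N where N: "\<And>n. n \<ge> N \<Longrightarrow> sqrt (real n) * 2 powr (2 - real n / 12) < \<eta>"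
    unfolding eventually_sequentially by blast
  have "real (n choose i) < \<eta> * real (n choose (n div 2)) / sqrt (real n)"
    if n: "n \<ge> max N 1" and i: "real i < real n / 4" for n i
  proof -
    define C where "C = real (n choose (n div 2))"
    have C0: "C > 0" unfolding C_def by simp
    have *: "real (n choose i) \<le> (1/2) ^ d * real (n choose (i + d))" if "3 * (i + d) \<le> n + 1" for d
      using that
    proof (induction d)
      case (Suc d)
      have "real (n choose (i + d)) \<le> 1/2 * real (n choose Suc (i + d))"
        using Suc(2) n by (intro binomial_ratio_le) (auto simp: of_nat_diff)
      then have "(1/2) ^ d * real (n choose (i + d)) \<le> (1/2) ^ d * (1/2 * real (n choose Suc (i + d)))"
        by (intro mult_left_mono) auto
      moreover have "real (n choose i) \<le> (1/2) ^ d * real (n choose (i + d))"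
        using Suc by simp
      ultimately have "real (n choose i) \<le> (1/2) ^ d * (1/2 * real (n choose Suc (i + d)))"
        by linarith
      then show ?case by (simp add: mult_ac)
    qed simp
    \<comment> \<open>From \<open>i < n / 4\<close> up to \<open>(n + 1) div 3\<close> there are at
      least \<open>n / 12 - 1\<close> doublings; the exponent \<open>2 - n / 12\<close> leaves
      slack.\<close>
    define d where "d = (n + 1) div 3 - i"
    have d: "3 * (i + d) \<le> n + 1" "real d \<ge> real n / 12 - 2 + 1" using i by (auto simp: d_def)
    have "real (n choose i) \<le> (1/2) ^ d * real (n choose (i + d))" using *[OF d(1)] .
    also have "\<dots> \<le> (1/2) ^ d * C" unfolding C_def by (intro mult_left_mono) (auto intro: binomial_maximum)
    also have "(1/2::real) ^ d = 2 powr (- real d)" by (simp add: powr_minus powr_realpow power_one_over inverse_eq_divide)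
    also have "2 powr (- real d) * C \<le> 2 powr (2 - real n / 12) * C"
      using d C0 by (intro mult_right_mono) auto
    also have "\<dots> < \<eta> / sqrt n * C"
      using N[of n] n C0 by (intro mult_strict_right_mono) (auto simp: field_simps)
    finally show ?thesis by (simp add: C_def)
  qed
  then show ?thesis by blast
qed

section \<open>Good pairs and supersaturation\<close>

text \<open>Both ends are strictly separated from \<open>H\<close>, so only inclusions between
  distinct members of \<open>H\<close> could prevent the copy from being induced.\<close>

lemma diamond_copy:
  assumes "A \<in> F" "B \<in> F" "H \<subseteq> F" "card H = s" "s \<ge> 1" "\<And>S. S \<in> H \<Longrightarrow> A \<subset> S \<and> S \<subset> B"
  shows diamond_copy_in_copies: "insert A (insert B H) \<in> copies (diamond s) (diamond_order s) F"
    and diamond_copy_in_induced_copies: "(\<And>S T. S \<in> H \<Longrightarrow> T \<in> H \<Longrightarrow> S \<subseteq> T \<Longrightarrow> S = T) \<Longrightarrow>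
      insert A (insert B H) \<in> induced_copies (diamond s) (diamond_order s) F"
proof -
  have "finite H" using assms(4,5) by (intro card_ge_0_finite) auto
  then obtain h where h: "bij_betw h {1..s} H"
    using ex_bij_betw_nat_finite_1 assms(4) by blast
  define i where "i = case_diamond_elem A h B"
  have i: "i Bottom = A" "i Top = B" "i (Middle j) = h j" for j by (auto simp: i_def)
  have hH: "h j \<in> H" if "1 \<le> j" "j \<le> s" for j using bij_betw_apply[OF h] that by simp
  have hI: "h j = h k \<Longrightarrow> j = k" if "1 \<le> j" "j \<le> s" "1 \<le> k" "k \<le> s" for j k
    using inj_onD[OF bij_betw_imp_inj_on[OF h], of j k] that by simp
  have hs: "A \<subset> h j" "h j \<subset> B" if "1 \<le> j" "j \<le> s" for j
    using assms(6)[OF hH[OF that]] by simp_all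
  \<comment> \<open>As \<open>s \<ge> 1\<close>, a middle set exists and separates \<open>A\<close>
    from \<open>B\<close>.\<close>
  have AB: "A \<subset> B" using hs[of 1] assms(5) by (meson order_refl psubset_trans)
  have el: "p = Bottom \<or> p = Top \<or> (\<exists>j. p = Middle j \<and> 1 \<le> j \<and> j \<le> s)" if "p \<in> diamond s" for p
    using that by (auto simp: diamond_def)
  have "inj_on i (diamond s)"
  proof (rule inj_onI)
    fix p q assume pq: "p \<in> diamond s" "q \<in> diamond s" "i p = i q"
    have ne: "h j \<noteq> A" "h j \<noteq> B" "A \<noteq> h j" "B \<noteq> h j" if "1 \<le> j" "j \<le> s" for j
      using hs[OF that] by auto
    have AB': "A \<noteq> B" "B \<noteq> A" using AB by auto
    show "p = q"
      using el[OF pq(1)] el[OF pq(2)]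
      by (elim disjE exE conjE) (use pq(3) in \<open>simp_all add: i ne AB' hI\<close>)
  qed
  moreover have "i ` diamond s = insert A (insert B H)"
    using bij_betw_imp_surj_on[OF h] by (simp add: diamond_def i image_image)
  ultimately have bij: "bij_betw i (diamond s) (insert A (insert B H))"
    by (simp add: bij_betw_def)
  have between: "A \<subseteq> i r \<and> i r \<subseteq> B" if "r \<in> diamond s" for r
    using el[OF that] AB
    by (elim disjE exE conjE) (use hs in \<open>simp_all add: i psubset_imp_subset\<close>)
  have le: "i p \<subseteq> i q" if "(p, q) \<in> diamond_order s" for p q
  proof -
    have pq: "p \<in> diamond s" "q \<in> diamond s" "p = q \<or> p = Bottom \<or> q = Top"
      using that by (auto simp: diamond_order_def)
    show ?thesis
      using pq(3) between[OF pq(1)] between[OF pq(2)] by (elim disjE) (simp_all add: i)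
  qed
  show "insert A (insert B H) \<in> copies (diamond s) (diamond_order s) F"
    unfolding copies_def using bij le assms(1-3) by blast
  assume anti: "\<And>S T. S \<in> H \<Longrightarrow> T \<in> H \<Longrightarrow> S \<subseteq> T \<Longrightarrow> S = T"
  have "(p, q) \<in> diamond_order s" if pq: "p \<in> diamond s" "q \<in> diamond s" "i p \<subseteq> i q" for p q
  proof (cases "p = Bottom \<or> q = Top")
    case False
    consider "p = Top" | j where "p = Middle j" "1 \<le> j" "j \<le> s"
      using el[OF pq(1)] False by blast
    then show ?thesis
    proof cases
      case 1
      then have "B \<subseteq> i q" using pq(3) i by simp
      moreover have "i q \<subset> B"
        using el[OF pq(2)] False AB hs by (elim disjE exE conjE) (simp_all add: i)
      ultimately show ?thesis by blast
    next
      case (2 j)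
      consider "q = Bottom" | k where "q = Middle k" "1 \<le> k" "k \<le> s"
        using el[OF pq(2)] False by blast
      then show ?thesis
      proof cases
        case 1
        then show ?thesis using pq(3) hs[of j] 2 by (auto simp: i)
      next
        case (2 k)
        then have "h j = h k" using \<open>p = Middle j\<close> pq(3) anti[OF hH[of j] hH[of k]] \<open>1 \<le> j\<close> \<open>j \<le> s\<close> by (simp add: i)
        then have "p = q" using hI[of j k] 2 \<open>p = Middle j\<close> \<open>1 \<le> j\<close> \<open>j \<le> s\<close> by simp
        then show ?thesis using pq by (simp add: diamond_order_def)
      qed
    qed
  qed (use pq in \<open>auto simp: diamond_order_def\<close>)
  then show "insert A (insert B H) \<in> induced_copies (diamond s) (diamond_order s) F"
    unfolding induced_copies_def using bij le assms(1-3) by blast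
qed

section \<open>Counting good pairs\<close>

text \<open>The strict inequality forces \<open>card (B - A) \<ge> m\<close> for finite
  \<open>B\<close>, because an interval of height \<open>k\<close> has average at most
  \<open>k + 1\<close>.\<close>

definition good_pairs :: "nat \<Rightarrow> 'a set set \<Rightarrow> ('a set \<times> 'a set) set" where
  "good_pairs m F = {(A, B). A \<in> F \<and> B \<in> F \<and> A \<subseteq> B \<and> real m < lubell (\<lambda>S. of_bool (S \<in> F)) A B}"

text \<open>The middle level is the largest, so the left side is at most the average of
  \<open>F\<close> on a random full chain. The summand of a pair is the probability that this chain
  passes through both sets.\<close>

lemma card_le_good_pairs:
  assumes "finite U" "F \<subseteq> Pow U" "1 \<le> m"
  shows "real (card F) / real (card U choose (card U div 2))
    \<le> real m + (\<Sum>(A, B)\<in>good_pairs m F. 1 / (real (card B choose card A) * real (card U choose card B)))"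
proof -
  define n where "n = card U"
  have P: "{{}..U} = Pow U" by auto
  have fF: "finite F" using assms finite_subset by auto
  have "real (card F) / real (n choose (n div 2)) = (\<Sum>S\<in>F. 1 / real (n choose (n div 2)))"
    by simp
  also have "\<dots> \<le> (\<Sum>S\<in>F. 1 / real (n choose card S))"
  proof (rule sum_mono)
    fix S assume "S \<in> F"
    then have "card S \<le> n" using assms by (auto simp: n_def intro: card_mono)
    then show "1 / real (n choose (n div 2)) \<le> 1 / real (n choose card S)"
      by (intro divide_left_mono) (auto simp: binomial_maximum)
  qed
  also have "\<dots> = (\<Sum>S\<in>Pow U. of_bool (S \<in> F) / real (n choose card S))"
    using assms by (intro sum.mono_neutral_cong_left) auto
  also have "\<dots> = lubell (\<lambda>S. of_bool (S \<in> F)) {} U"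
    unfolding lubell_def P by (simp add: n_def)
  also have "\<dots> \<le> real m + lubell (\<lambda>B. of_bool (B \<in> F) *
         lubell (\<lambda>S. of_bool (S \<in> F \<and> real m < lubell (\<lambda>S. of_bool (S \<in> F)) S B)) {} B) {} U"
    using assms by (intro lubell_le_good_pairs) auto
  also have "lubell (\<lambda>B. of_bool (B \<in> F) *
         lubell (\<lambda>S. of_bool (S \<in> F \<and> real m < lubell (\<lambda>S. of_bool (S \<in> F)) S B)) {} B) {} U
     = (\<Sum>B\<in>Pow U. \<Sum>A\<in>Pow U. of_bool ((A, B) \<in> good_pairs m F) / (real (card B choose card A) * real (n choose card B)))"
    unfolding lubell_def[of _ "{}" U] P
  proof (rule sum.cong)
    fix B assume B: "B \<in> Pow U"
    have "of_bool (B \<in> F) * lubell (\<lambda>S. of_bool (S \<in> F \<and> real m < lubell (\<lambda>S. of_bool (S \<in> F)) S B)) {} B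
      = (\<Sum>A\<in>{{}..B}. of_bool ((A, B) \<in> good_pairs m F) / real (card B choose card A))"
      unfolding lubell_def[of _ "{}" B] sum_distrib_left
      by (rule sum.cong) (auto simp: good_pairs_def)
    also have "\<dots> = (\<Sum>A\<in>Pow U. of_bool ((A, B) \<in> good_pairs m F) / real (card B choose card A))"
    proof (rule sum.mono_neutral_left)
      show "{{}..B} \<subseteq> Pow U" using B by (auto, blast)
    qed (use assms(1) in \<open>auto simp: good_pairs_def\<close>)
    finally show "of_bool (B \<in> F) * lubell (\<lambda>S. of_bool (S \<in> F \<and> real m < lubell (\<lambda>S. of_bool (S \<in> F)) S B)) {} B
       / real (card (U - {}) choose card (B - {})) =
      (\<Sum>A\<in>Pow U. of_bool ((A, B) \<in> good_pairs m F) / (real (card B choose card A) * real (n choose card B)))"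
      by (simp add: sum_divide_distrib n_def)
  qed simp
  also have "\<dots> = (\<Sum>(A, B)\<in>Pow U \<times> Pow U. of_bool ((A, B) \<in> good_pairs m F) / (real (card B choose card A) * real (n choose card B)))"
    by (subst sum.swap) (rule sum.cartesian_product)
  also have "\<dots> = (\<Sum>(A, B)\<in>good_pairs m F. 1 / (real (card B choose card A) * real (n choose card B)))"
    using assms by (intro sum.mono_neutral_cong_right) (auto simp: good_pairs_def)
  finally show ?thesis by (simp add: n_def)
qed

text \<open>The copy chosen for a pair determines the pair through its intersection and union, so
  distinct pairs get distinct copies.\<close>

lemma card_good_pairs_le:
  assumes "finite (cop F)"
    and "\<And>A B. (A, B) \<in> good_pairs m F \<Longrightarrow> \<exists>G\<in>cop F. \<Inter>G = A \<and> \<Union>G = B"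
  shows "card (good_pairs m F) \<le> card (cop F)"
proof -
  have "\<forall>p\<in>good_pairs m F. \<exists>G. G \<in> cop F \<and> (\<Inter>G, \<Union>G) = p"
    using assms(2) by fastforce
  then obtain g where g: "\<And>p. p \<in> good_pairs m F \<Longrightarrow> g p \<in> cop F \<and> (\<Inter>(g p), \<Union>(g p)) = p"
    by metis
  have "inj_on g (good_pairs m F)" by (rule inj_onI) (metis g)
  then show ?thesis using g assms(1) by (intro card_inj_on_le) auto
qed

text \<open>As \<open>a\<close> is at distance at least \<open>m\<close> from both ends of the row,
  unimodality gives \<open>b choose m \<le> b choose a\<close>.\<close>

lemma binomial_ge_pow:
  assumes "m \<le> a" "a + m \<le> b"
  shows "(real b / real m) ^ m \<le> real (b choose a)"
proof -
  have "b choose m \<le> b choose a"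
  proof (cases "2 * a \<le> b")
    case True
    then show ?thesis using assms by (intro binomial_mono) auto
  next
    case False
    then have "b choose m \<le> b choose (b - a)" using assms by (intro binomial_mono) auto
    then show ?thesis using assms binomial_symmetric[of a b] by simp
  qed
  moreover have "(real b / real m) ^ m \<le> real (b choose m)"
    using assms by (intro binomial_ge_n_over_k_pow_k) auto
  ultimately show ?thesis by (meson of_nat_le_iff order_trans)
qed

text \<open>\<open>cop\<close> is abstract so that ordinary and induced copies are covered at once.
  In the trimmed family the good pairs have total weight at least \<open>\<epsilon> / 2\<close>;
  dividing by the largest weight of one pair gives their number.\<close>

lemma supersaturation:
  fixes cop :: "nat set set \<Rightarrow> nat set set set" and \<epsilon> :: real
  assumes m: "1 \<le> m" and \<epsilon>: "0 < \<epsilon>"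
    and sub: "\<And>F. cop F \<subseteq> Pow F"
    and mono: "\<And>F F'. F \<subseteq> F' \<Longrightarrow> cop F \<subseteq> cop F'"
    and ex: "\<And>F A B. finite B \<Longrightarrow> (A, B) \<in> good_pairs m F \<Longrightarrow> \<exists>G\<in>cop F. \<Inter>G = A \<and> \<Union>G = B"
  shows "\<exists>\<delta>::real. \<delta> > 0 \<and> (\<forall>n F. F \<subseteq> Pow {1..n} \<and>
      real (card F) \<ge> (real m + \<epsilon>) * real (n choose (n div 2)) \<longrightarrow>
      real (card (cop F)) \<ge> \<delta> * real n powr (real m - 0.5) * real (n choose (n div 2)))"
proof -
  \<comment> \<open>The discarded levels cost \<open>8 * \<eta>\<close> times the middle level, that
    is, half of the surplus \<open>\<epsilon>\<close>.\<close>
  define \<eta> where "\<eta> = \<epsilon> / 16"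
  have \<eta>: "\<eta> > 0" using \<epsilon> by (simp add: \<eta>_def)
  obtain N0 where N0: "\<And>n i. n \<ge> N0 \<Longrightarrow> real i < real n / 4 \<Longrightarrow>
     real (n choose i) < \<eta> * real (n choose (n div 2)) / sqrt (real n)"
    using low_binomials_small[OF \<eta>] by blast
  \<comment> \<open>The term \<open>4 * m\<close> ensures that sets of size at least
    \<open>n / 4\<close> have size at least \<open>m\<close>.\<close>
  define N where "N = max (max N0 2) (4 * m)"
  \<comment> \<open>What is left of \<open>\<epsilon> / 2 * ((n / (4 * m)) ^ m * t)\<close> once the
    powers of \<open>n\<close> and the factor \<open>C\<close> are split off.\<close>
  define \<delta>1 where "\<delta>1 = \<epsilon> / 2 * \<eta> / (4 * real m) ^ m"
  \<comment> \<open>Scaled so that the claimed count is at most \<open>1\<close> for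
    \<open>n < N\<close>.\<close>
  define \<delta>2 where "\<delta>2 = 1 / (real N ^ m * 2 ^ N)"
  have N: "N \<ge> 2" "N \<ge> N0" "N \<ge> 4 * m" by (auto simp: N_def)
  have \<delta>: "\<delta>1 > 0" "\<delta>2 > 0" using \<epsilon> \<eta> m N by (auto simp: \<delta>1_def \<delta>2_def)
  have gp_le: "card (good_pairs m F') \<le> card (cop F)" if "F' \<subseteq> F" "F \<subseteq> Pow {1..n}" for n F' F
  proof -
    have fF: "finite F" using that(2) finite_subset by auto
    have "card (good_pairs m F') \<le> card (cop F')"
    proof (rule card_good_pairs_le)
      show "finite (cop F')"
        using sub[of F'] fF that(1) by (meson finite_Pow_iff finite_subset)
      fix A B assume AB: "(A, B) \<in> good_pairs m F'"
      then have "B \<subseteq> {1..n}" using that by (auto simp: good_pairs_def)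
      then show "\<exists>G\<in>cop F'. \<Inter>G = A \<and> \<Union>G = B"
        using AB by (intro ex) (auto intro: finite_subset)
    qed
    also have "\<dots> \<le> card (cop F)"
      using sub[of F] fF by (intro card_mono mono that) (meson finite_Pow_iff finite_subset)
    finally show ?thesis .
  qed
  \<comment> \<open>For small \<open>n\<close> a single copy suffices.\<close>
  have small: "\<delta>2 * real n powr (real m - 0.5) * C \<le> real (card (cop F))"
    if n: "n < N" and F: "F \<subseteq> Pow {1..n}" "real (card F) \<ge> (real m + \<epsilon>) * C" and C: "C = real (n choose (n div 2))" for n F C
  proof -
    have C0: "C > 0" by (simp add: C)
    have "real m + \<epsilon> \<le> real (card F) / C" using F(2) C0 by (simp add: field_simps)
    also have "\<dots> \<le> real m + (\<Sum>(A, B)\<in>good_pairs m F. 1 / (real (card B choose card A) * real (n choose card B)))"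
      using card_le_good_pairs[OF _ F(1) m] by (simp add: C)
    finally have "\<epsilon> \<le> (\<Sum>(A, B)\<in>good_pairs m F. 1 / (real (card B choose card A) * real (n choose card B)))"
      by simp
    then have "good_pairs m F \<noteq> {}" using \<epsilon> by (intro notI) simp
    moreover have "finite (good_pairs m F)"
    proof (rule finite_subset)
      show "good_pairs m F \<subseteq> F \<times> F" by (auto simp: good_pairs_def)
      have "finite F" using F(1) by (rule finite_subset) simp
      then show "finite (F \<times> F)" by simp
    qed
    ultimately have "1 \<le> card (good_pairs m F)" by (simp add: Suc_le_eq card_gt_0_iff)
    then have 1: "1 \<le> real (card (cop F))" using gp_le[OF order_refl F(1)] by linarith
    have "real n powr (real m - 0.5) \<le> real N ^ m"
    \<comment> \<open>For \<open>n = 0\<close> the left side is \<open>0\<close> by the convention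
      for \<open>powr\<close>.\<close>
    proof (cases "n = 0")
      case False
      then have "real n powr (real m - 0.5) \<le> real n powr real m" by (intro powr_mono) auto
      also have "\<dots> = real n ^ m" using False by (simp add: powr_realpow)
      also have "\<dots> \<le> real N ^ m" using n by (intro power_mono) auto
      finally show ?thesis .
    qed auto
    moreover have "C \<le> 2 ^ N"
    proof -
      have "C \<le> 2 ^ n" unfolding C using binomial_le_pow2[of n "n div 2"] by (metis of_nat_le_iff of_nat_numeral of_nat_power)
      also have "\<dots> \<le> (2::real) ^ N" using n by (intro power_increasing) auto
      finally show ?thesis .
    qed
    ultimately have "real n powr (real m - 0.5) * C \<le> real N ^ m * 2 ^ N"
      using C0 by (intro mult_mono) auto
    then have "\<delta>2 * (real n powr (real m - 0.5) * C) \<le> \<delta>2 * (real N ^ m * 2 ^ N)"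
      using \<delta> by (intro mult_left_mono) auto
    also have "\<dots> = 1" using N by (simp add: \<delta>2_def)
    finally show ?thesis using 1 by (simp add: mult.assoc)
  qed
  have large: "\<delta>1 * real n powr (real m - 0.5) * C \<le> real (card (cop F))"
    if n: "n \<ge> N" and F: "F \<subseteq> Pow {1..n}" "real (card F) \<ge> (real m + \<epsilon>) * C" and C: "C = real (n choose (n div 2))" for n F C
  proof -
    have C0: "C > 0" by (simp add: C)
    have n2: "n \<ge> 2" using n N by simp
    have fF: "finite F" using F(1) finite_subset by auto
    define t where "t = \<eta> * C / sqrt (real n)"
    have t0: "t > 0" using \<eta> C0 n2 by (simp add: t_def)
    define F' where "F' = {S \<in> F. t \<le> real (n choose card S)}"
    define I where "I = {i. i \<le> n \<and> real (n choose i) < t}"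
    have fI: "finite I" by (rule finite_subset[of _ "{..n}"]) (auto simp: I_def)
    have "F - F' \<subseteq> (\<Union>i\<in>I. {S. S \<subseteq> {1..n} \<and> card S = i})"
    proof
      fix S assume S: "S \<in> F - F'"
      then have "card S \<le> n" using F(1) card_mono[of "{1..n}" S] by auto
      then show "S \<in> (\<Union>i\<in>I. {S. S \<subseteq> {1..n} \<and> card S = i})" using S F(1) by (auto simp: F'_def I_def)
    qed
    then have "card (F - F') \<le> card (\<Union>i\<in>I. {S. S \<subseteq> {1..n} \<and> card S = i})"
      by (intro card_mono finite_UN_I fI) auto
    also have "\<dots> \<le> (\<Sum>i\<in>I. card {S. S \<subseteq> {1..n} \<and> card S = i})"
      by (rule card_UN_le[OF fI])
    also have "\<dots> = (\<Sum>i\<in>I. n choose i)"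
      using n_subsets[of "{1..n}"] by simp
    finally have "real (card (F - F')) \<le> real (\<Sum>i\<in>I. n choose i)" by (simp only: of_nat_le_iff)
    then have "real (card (F - F')) \<le> 8 * \<eta> * C"
      using sum_small_binomials[OF n2 \<eta>] by (simp add: I_def t_def C)
    moreover have "card F = card F' + card (F - F')"
      using fF by (subst card_Diff_subset) (auto simp: F'_def card_mono intro: finite_subset)
    ultimately have cF': "(real m + \<epsilon> / 2) * C \<le> real (card F')"
      using F(2) by (simp add: \<eta>_def algebra_simps)
    \<comment> \<open>Upper bound for the weight of a pair: \<open>binomial_ge_pow\<close> controls
      the choice of \<open>A\<close> below \<open>B\<close>, the cutoff \<open>t\<close> that of
      \<open>B\<close>.\<close>
    define q where "q = 1 / ((real n / (4 * real m)) ^ m * t)"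
    have n0: "(real n / (4 * real m)) ^ m > 0" using n2 m by simp
    have bound: "1 / (real (card B choose card A) * real (n choose card B)) \<le> q" if "(A, B) \<in> good_pairs m F'" for A B
    proof -
      have AB: "A \<in> F'" "B \<in> F'" "A \<subseteq> B" "real m < lubell (\<lambda>S. of_bool (S \<in> F')) A B"
        using that by (auto simp: good_pairs_def)
      have "B \<subseteq> {1..n}" using AB F(1) by (auto simp: F'_def)
      then have fB: "finite B" by (rule finite_subset) simp
      have "real m < real (card (B - A)) + 1"
        using AB lubell_le_card[OF fB AB(3), of F'] by linarith
      then have "m \<le> card B - card A" using AB(3) fB by (simp add: card_Diff_subset finite_subset)
      have nl: "real n / 4 \<le> real (card S)" if "S \<in> F'" for S
        using N0[of n "card S"] n N that by (fastforce simp: F'_def t_def C)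
      have a: "m \<le> card A" using nl[OF AB(1)] n N by linarith
      \<comment> \<open>\<open>1 \<le> m\<close> excludes that the truncated difference is
        \<open>0\<close>.\<close>
      have "card A + m \<le> card B" using \<open>m \<le> card B - card A\<close> m by linarith
      then have "(real (card B) / real m) ^ m \<le> real (card B choose card A)"
        using a by (intro binomial_ge_pow)
      moreover have "(real n / (4 * real m)) ^ m \<le> (real (card B) / real m) ^ m"
        using nl[OF AB(2)] m by (intro power_mono) (auto simp: field_simps)
      ultimately have "(real n / (4 * real m)) ^ m * t \<le> real (card B choose card A) * real (n choose card B)"
        using AB(2) t0 n0 by (intro mult_mono) (auto simp: F'_def)
      then show ?thesis unfolding q_def using n0 t0 by (intro divide_left_mono) (auto intro: mult_pos_pos less_le_trans[OF mult_pos_pos[OF n0 t0]])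
    qed
    have F'n: "F' \<subseteq> Pow {1..n}" using F(1) by (auto simp: F'_def)
    have "real m + \<epsilon> / 2 \<le> real (card F') / C" using cF' C0 by (simp add: field_simps)
    also have "\<dots> \<le> real m + (\<Sum>(A, B)\<in>good_pairs m F'. 1 / (real (card B choose card A) * real (n choose card B)))"
      using card_le_good_pairs[OF _ F'n m] by (simp add: C)
    also have "(\<Sum>(A, B)\<in>good_pairs m F'. 1 / (real (card B choose card A) * real (n choose card B)))
       \<le> real (card (good_pairs m F')) * q"
      by (rule sum_bounded_above) (use bound in auto)
    finally have "\<epsilon> / 2 \<le> real (card (good_pairs m F')) * q" by simp
    then have "\<epsilon> / 2 * ((real n / (4 * real m)) ^ m * t) \<le> real (card (good_pairs m F'))"
      unfolding q_def using mult_pos_pos[OF n0 t0] by (simp only: pos_le_divide_eq times_divide_eq_right mult_1_right)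
    also have "\<dots> \<le> real (card (cop F))" using gp_le[of F' F n] F(1) by (simp add: F'_def)
    also have "\<epsilon> / 2 * ((real n / (4 * real m)) ^ m * t) = \<delta>1 * (real n ^ m / sqrt (real n)) * C"
      by (simp add: \<delta>1_def t_def power_divide power_mult_distrib mult_ac)
    also have "real n ^ m / sqrt (real n) = real n powr (real m - 0.5)"
      using n2 by (simp add: powr_diff powr_realpow powr_half_sqrt)
    finally show ?thesis .
  qed
  have "min \<delta>1 \<delta>2 * real n powr (real m - 0.5) * real (n choose (n div 2)) \<le> real (card (cop F))"
    if F: "F \<subseteq> Pow {1..n}" "real (card F) \<ge> (real m + \<epsilon>) * real (n choose (n div 2))" for n F
  proof (cases "n < N")
    case True
    have "min \<delta>1 \<delta>2 * real n powr (real m - 0.5) * real (n choose (n div 2)) \<le> \<delta>2 * real n powr (real m - 0.5) * real (n choose (n div 2))"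
      by (intro mult_right_mono) auto
    then show ?thesis using small[OF True F refl] by linarith
  next
    case False
    have "min \<delta>1 \<delta>2 * real n powr (real m - 0.5) * real (n choose (n div 2)) \<le> \<delta>1 * real n powr (real m - 0.5) * real (n choose (n div 2))"
      by (intro mult_right_mono) auto
    then show ?thesis using large[OF _ F refl] False by (meson not_le order_trans)
  qed
  then show ?thesis using \<delta> by (intro exI[of _ "min \<delta>1 \<delta>2"]) auto
qed

section \<open>Passage to ordinary and induced diamonds\<close>

lemma copies_subset_Pow: "copies P r F \<subseteq> Pow F" "induced_copies P r F \<subseteq> Pow F"
  by (auto simp: copies_def induced_copies_def)

lemma copies_mono: "F \<subseteq> F' \<Longrightarrow> copies P r F \<subseteq> copies P r F'"
    "F \<subseteq> F' \<Longrightarrow> induced_copies P r F \<subseteq> induced_copies P r F'"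
  by (auto simp: copies_def induced_copies_def)

text \<open>By the contrapositive of \<open>card\<close>, a good pair has \<open>s\<close> members
  of \<open>F\<close> strictly between its ends, and together they form a diamond from which
  \<open>A\<close> and \<open>B\<close> are recovered.\<close>

lemma supersaturation_copies:
  assumes "1 \<le> s" "1 \<le> m" "0 < \<epsilon>"
    and card: "\<And>F A B. finite B \<Longrightarrow> A \<subseteq> B \<Longrightarrow>
      card {S \<in> F. A \<subset> S \<and> S \<subset> B} < s \<Longrightarrow> lubell (\<lambda>S. of_bool (S \<in> F)) A (B :: nat set) \<le> real m"
  shows "\<exists>\<delta>::real. \<delta> > 0 \<and> (\<forall>n (F :: nat set set). F \<subseteq> Pow {1..n} \<and>
      real (card F) \<ge> (real m + \<epsilon>) * real (n choose (n div 2)) \<longrightarrow>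
      real (card (copies (diamond s) (diamond_order s) F)) \<ge> \<delta> * real n powr (real m - 0.5) * real (n choose (n div 2)))"
proof (rule supersaturation)
  fix F :: "nat set set" and A B assume B: "finite B" and "(A, B) \<in> good_pairs m F"
  then have AB: "A \<in> F" "B \<in> F" "A \<subseteq> B" "s \<le> card {S \<in> F. A \<subset> S \<and> S \<subset> B}"
    using card[of B A F] by (fastforce simp: good_pairs_def)+
  obtain H where H: "H \<subseteq> {S \<in> F. A \<subset> S \<and> S \<subset> B}" "card H = s"
    using obtain_subset_with_card_n[OF AB(4)] by metis
  then have "H \<noteq> {}" using assms(1) by auto
  have "insert A (insert B H) \<in> copies (diamond s) (diamond_order s) F"
    by (rule diamond_copy_in_copies) (use AB H assms(1) in auto)
  moreover have "\<Inter>(insert A (insert B H)) = A" "\<Union>(insert A (insert B H)) = B"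
    using H AB by auto
  ultimately show "\<exists>G\<in>copies (diamond s) (diamond_order s) F. \<Inter>G = A \<and> \<Union>G = B" by blast
qed (use assms in \<open>simp_all add: copies_subset_Pow copies_mono\<close>)

text \<open>Sets on one level form an antichain, so an inner level with \<open>s\<close> members of
  \<open>F\<close> yields an induced diamond; by \<open>level\<close>, every good pair has such a
  level.\<close>

lemma supersaturation_induced_copies:
  assumes "1 \<le> s" "1 \<le> m" "0 < \<epsilon>"
    and level: "\<And>k x. (\<And>i. x i \<le> k choose i) \<Longrightarrow> (\<And>i. 0 < i \<Longrightarrow> i < k \<Longrightarrow> x i < s) \<Longrightarrow>
      (\<Sum>i\<le>k. real (x i) / real (k choose i)) \<le> real m"
  shows "\<exists>\<delta>::real. \<delta> > 0 \<and> (\<forall>n (F :: nat set set). F \<subseteq> Pow {1..n} \<and>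
      real (card F) \<ge> (real m + \<epsilon>) * real (n choose (n div 2)) \<longrightarrow>
      real (card (induced_copies (diamond s) (diamond_order s) F)) \<ge> \<delta> * real n powr (real m - 0.5) * real (n choose (n div 2)))"
proof (rule supersaturation)
  fix F :: "nat set set" and A B assume B: "finite B" and "(A, B) \<in> good_pairs m F"
  then have AB: "A \<in> F" "B \<in> F" "A \<subseteq> B" "real m < lubell (\<lambda>S. of_bool (S \<in> F)) A B"
    by (auto simp: good_pairs_def)
  define X where "X i = {S \<in> F. A \<subseteq> S \<and> S \<subseteq> B \<and> card (S - A) = i}" for i
  have "\<exists>i. 0 < i \<and> i < card (B - A) \<and> s \<le> card (X i)"
  proof (rule ccontr)
    assume "\<nexists>i. 0 < i \<and> i < card (B - A) \<and> s \<le> card (X i)"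
    then have "(\<Sum>i\<le>card (B - A). real (card (X i)) / real (card (B - A) choose i)) \<le> real m"
      using card_interval_level_le[OF B, of F A] unfolding X_def by (intro level) force+
    then show False
      using AB(4) lubell_eq_profile[OF B AB(3), of F] unfolding X_def by linarith
  qed
  then obtain i where i: "0 < i" "i < card (B - A)" "s \<le> card (X i)" by blast
  obtain H where H: "H \<subseteq> X i" "card H = s"
    using obtain_subset_with_card_n[OF i(3)] by metis
  have strict: "A \<subset> S \<and> S \<subset> B" if "S \<in> X i" for S
    using that i by (auto simp: X_def)
  have anti: "S = T" if "S \<in> X i" "T \<in> X i" "S \<subseteq> T" for S T
  proof -
    have "finite (T - A)" using that B finite_subset by (auto simp: X_def)
    then have "S - A = T - A" using that by (intro card_subset_eq) (auto simp: X_def)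
    then show ?thesis using that by (auto simp: X_def)
  qed
  have "insert A (insert B H) \<in> induced_copies (diamond s) (diamond_order s) F"
  proof (rule diamond_copy_in_induced_copies)
    show "H \<subseteq> F" using H by (auto simp: X_def)
    show "A \<subset> S \<and> S \<subset> B" if "S \<in> H" for S using that H strict by blast
    show "S = T" if "S \<in> H" "T \<in> H" "S \<subseteq> T" for S T using that H anti by blast
  qed (use AB H assms(1) in auto)
  moreover have "H \<noteq> {}" using H assms(1) by auto
  then have "\<Inter>(insert A (insert B H)) = A" "\<Union>(insert A (insert B H)) = B"
    using H strict AB by blast+
  ultimately show "\<exists>G\<in>induced_copies (diamond s) (diamond_order s) F. \<Inter>G = A \<and> \<Union>G = B" by blast
qed (use assms in \<open>simp_all add: copies_subset_Pow copies_mono\<close>)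

section \<open>Averages in intervals without diamonds\<close>

lemma central_binomial_ceil: "m choose ((m + 1) div 2) = m choose (m div 2)"
proof -
  have "m - m div 2 = (m + 1) div 2" by simp
  then show ?thesis using binomial_symmetric[of "m div 2" m] by simp
qed

text \<open>Unimodality of row \<open>k\<close> replaces \<open>i\<close> by \<open>h\<close>; then
  the coefficient grows with the row.\<close>

lemma binomial_ge_of_sides:
  assumes "m \<le> k" "h \<le> i" "h \<le> k - i" "i \<le> k"
  shows "m choose h \<le> k choose i"
proof -
  have "k choose h \<le> k choose i"
  proof (cases "2 * i \<le> k")
    case True
    then show ?thesis using assms by (intro binomial_mono) auto
  next
    case False
    then have "k choose h \<le> k choose (k - i)" using assms by (intro binomial_mono) auto
    then show ?thesis using assms binomial_symmetric[of i k] by simp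
  qed
  then show ?thesis using binomial_right_mono[OF assms(1), of h] by linarith
qed

text \<open>Linear programming duality with the multiplier \<open>\<theta> = 1 / (m choose \<lceil>m/2\<rceil>)\<close>: every level
  contributes at most \<open>\<theta> x i + max 0 (1 - \<theta> (k choose i))\<close>, and the sum of the maxima does not
  increase when \<open>k\<close> grows from \<open>m\<close>.\<close>

lemma profile_le_of_total:
  assumes "m \<le> k" and x: "\<And>i. x i \<le> k choose i"
    and total: "(\<Sum>i\<le>k. x i) + (m choose ((m + 1) div 2)) \<le> 2 ^ m"
  shows "(\<Sum>i\<le>k. real (x i) / real (k choose i)) \<le> real m"
proof -
  define h where "h = (m + 1) div 2"
  define \<theta> where "\<theta> = 1 / real (m choose h)"
  have hm: "h \<le> m" by (simp add: h_def)
  then have c0: "real (m choose h) > 0" by simp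
  have \<theta>0: "\<theta> > 0" using c0 by (simp add: \<theta>_def)
  define g where "g n i = max 0 (1 - \<theta> * real (n choose i))" for n i
  have g0: "0 \<le> g n i" for n i by (simp add: g_def)
  \<comment> \<open>On a level of size at least \<open>1 / \<theta>\<close> a set weighs at most
    \<open>\<theta>\<close>; on a smaller one the excess over \<open>\<theta> * x i\<close> is
    largest when the level is full.\<close>
  have level_bound: "real (x i) / real (k choose i) \<le> \<theta> * real (x i) + g k i" if "i \<le> k" for i
  proof (cases "1 \<le> \<theta> * real (k choose i)")
    case True
    have "1 / real (k choose i) \<le> \<theta>" using True that by (simp add: field_simps)
    then have "real (x i) * (1 / real (k choose i)) \<le> real (x i) * \<theta>" by (intro mult_left_mono) auto
    then show ?thesis using g0[of k i] by (simp add: mult.commute)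
  next
    case False
    have p: "real (k choose i) > 0" using that by simp
    have "0 \<le> 1 / real (k choose i) - \<theta>" using False p by (simp add: field_simps)
    then have "real (x i) * (1 / real (k choose i) - \<theta>) \<le> real (k choose i) * (1 / real (k choose i) - \<theta>)"
      using x[of i] by (intro mult_right_mono) auto
    also have "\<dots> = 1 - \<theta> * real (k choose i)" using p by (simp add: right_diff_distrib)
    also have "\<dots> \<le> g k i" by (simp add: g_def)
    finally show ?thesis by (simp add: algebra_simps)
  qed
  have gz: "g k i = 0" if "h \<le> i" "h \<le> k - i" "i \<le> k" for i
  proof -
    have "1 \<le> \<theta> * real (k choose i)"
      using binomial_ge_of_sides[OF assms(1) that] c0 by (simp add: \<theta>_def)
    then show ?thesis by (simp add: g_def)
  qed
  have gm: "g k i \<le> g m i" for i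
  proof -
    have "\<theta> * real (m choose i) \<le> \<theta> * real (k choose i)"
      using \<theta>0 binomial_right_mono[OF assms(1), of i] by (intro mult_left_mono) auto
    then show ?thesis by (auto simp: g_def)
  qed
  have gsym: "g n (n - i) = g n i" if "i \<le> n" for n i
    using binomial_symmetric[OF that] by (simp add: g_def)
  have gi: "g k i \<le> (if i < h then g k i else 0) + (if k - i < h then g k (k - i) else 0)" if "i \<le> k" for i
    using gz[of i] gsym[OF that] g0[of k i] that by (auto simp: not_less)
  have sum_reflect: "(\<Sum>i\<le>k. f (k - i)) = (\<Sum>i\<le>k. f i)" for k and f :: "nat \<Rightarrow> real"
    by (rule sum.reindex_bij_witness[of _ "\<lambda>i. k - i" "\<lambda>i. k - i"]) auto
  have sub: "(\<Sum>i\<le>n. if i < h then f i else 0) = (\<Sum>i<h. f i)" if "h \<le> n" for n and f :: "nat \<Rightarrow> real"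
    using that by (subst sum.inter_filter[symmetric]) (auto intro!: sum.cong)
  have "(\<Sum>i\<le>k. g k i) \<le> (\<Sum>i\<le>k. (if i < h then g k i else 0) + (if k - i < h then g k (k - i) else 0))"
    by (intro sum_mono gi) auto
  also have "\<dots> = 2 * (\<Sum>i<h. g k i)"
    using sum_reflect[of "\<lambda>i. if i < h then g k i else 0" k] sub[of k "g k"] hm assms(1)
    by (simp add: sum.distrib)
  also have "\<dots> \<le> 2 * (\<Sum>i<h. g m i)"
    by (intro mult_left_mono sum_mono gm) auto
  also have "\<dots> = (\<Sum>i\<le>m. (if i < h then g m i else 0) + (if m - i < h then g m (m - i) else 0))"
    using sum_reflect[of "\<lambda>i. if i < h then g m i else 0" m] sub[of m "g m"] hm
    by (simp add: sum.distrib)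
  also have "\<dots> \<le> (\<Sum>i\<le>m. g m i)"
  proof (rule sum_mono)
    fix i assume i: "i \<in> {..m}"
    \<comment> \<open>Both together would give \<open>m \<le> 2 * h - 2\<close>, against
      \<open>2 * h \<le> m + 1\<close>. So the two halves are disjoint when
      \<open>k = m\<close>.\<close>
    have "\<not> (i < h \<and> m - i < h)" using i by (auto simp: h_def)
    then show "(if i < h then g m i else 0) + (if m - i < h then g m (m - i) else 0) \<le> g m i"
      using gsym[of i m] g0[of m i] i by auto
  qed
  \<comment> \<open>In row \<open>m\<close> no coefficient exceeds \<open>1 / \<theta>\<close>, so
    each maximum is its second argument.\<close>
  also have "\<dots> = (\<Sum>i\<le>m. 1 - \<theta> * real (m choose i))"
  proof (rule sum.cong)
    fix i
    have "m choose i \<le> m choose h" unfolding h_def central_binomial_ceil by (rule binomial_maximum)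
    then show "g m i = 1 - \<theta> * real (m choose i)" using c0 by (simp add: g_def \<theta>_def)
  qed simp
  also have "\<dots> = real m + 1 - \<theta> * real (\<Sum>i\<le>m. m choose i)"
    by (simp add: sum_subtractf sum_distrib_left)
  also have "(\<Sum>i\<le>m. m choose i) = 2 ^ m" by (rule choose_row_sum)
  finally have G: "(\<Sum>i\<le>k. g k i) \<le> real m + 1 - \<theta> * real (2 ^ m)" .
  have "(\<Sum>i\<le>k. real (x i) / real (k choose i)) \<le> (\<Sum>i\<le>k. \<theta> * real (x i) + g k i)"
    by (intro sum_mono level_bound) auto
  also have "\<dots> = \<theta> * real (\<Sum>i\<le>k. x i) + (\<Sum>i\<le>k. g k i)"
    by (simp add: sum.distrib sum_distrib_left)
  also have "\<dots> \<le> \<theta> * real (\<Sum>i\<le>k. x i) + (real m + 1 - \<theta> * real (2 ^ m))" using G by simp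
  also have "\<dots> \<le> real m"
  proof -
    have "real ((\<Sum>i\<le>k. x i) + (m choose h)) \<le> real (2 ^ m)"
      using total unfolding h_def by (simp only: of_nat_le_iff)
    then have "\<theta> * (real (\<Sum>i\<le>k. x i) + real (m choose h)) \<le> \<theta> * real (2 ^ m)"
      using \<theta>0 by (intro mult_left_mono) auto
    \<comment> \<open>This cancels the extra \<open>1\<close> in \<open>m + 1\<close>.\<close>
    moreover have "\<theta> * real (m choose h) = 1" using c0 by (simp add: \<theta>_def)
    ultimately show ?thesis by (simp add: distrib_left)
  qed
  finally show ?thesis .
qed

text \<open>Heights below \<open>m\<close> are settled by the chain length. Otherwise the level
  counts sum to at most \<open>s + 1\<close>: fewer than \<open>s\<close> interior sets and the two
  ends.\<close>

lemma lubell_le_of_interior: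
  assumes "finite B" "A \<subseteq> B" "card {S \<in> F. A \<subset> S \<and> S \<subset> B} < s"
    and "s + 1 + (m choose ((m + 1) div 2)) \<le> 2 ^ m"
  shows "lubell (\<lambda>S. of_bool (S \<in> F)) A B \<le> real m"
proof (cases "card (B - A) < m")
  case True
  then show ?thesis using lubell_le_card[OF assms(1,2), of F] by linarith
next
  case False
  define X where "X i = {S \<in> F. A \<subseteq> S \<and> S \<subseteq> B \<and> card (S - A) = i}" for i
  have fX: "finite {S \<in> F. A \<subseteq> S \<and> S \<subseteq> B}"
    by (rule finite_subset[of _ "Pow B"]) (use assms(1) in auto)
  have U: "(\<Union>i\<in>{..card (B - A)}. X i) = {S \<in> F. A \<subseteq> S \<and> S \<subseteq> B}"
    using assms(1,2) by (auto simp: X_def intro!: card_mono)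
  have "(\<Sum>i\<le>card (B - A). card (X i)) = card (\<Union>i\<in>{..card (B - A)}. X i)"
  proof (rule card_UN_disjoint[symmetric])
    show "\<forall>i\<in>{..card (B - A)}. finite (X i)"
    proof
      fix i show "finite (X i)" by (rule finite_subset[OF _ fX]) (auto simp: X_def)
    qed
  qed (auto simp: X_def)
  also have "\<dots> \<le> card (insert A (insert B {S \<in> F. A \<subset> S \<and> S \<subset> B}))"
    unfolding U by (intro card_mono) (auto intro: finite_subset[OF _ fX])
  also have "\<dots> \<le> card {S \<in> F. A \<subset> S \<and> S \<subset> B} + 2"
  proof -
    have "card (insert S Y) \<le> card Y + 1" for S and Y :: "'a set set"
      by (cases "finite Y") (simp_all add: card_insert_if)
    from this[of A "insert B {S \<in> F. A \<subset> S \<and> S \<subset> B}"] this[of B "{S \<in> F. A \<subset> S \<and> S \<subset> B}"]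
    show ?thesis by linarith
  qed
  finally have "(\<Sum>i\<le>card (B - A). card (X i)) \<le> s + 1" using assms(3) by linarith
  then have "(\<Sum>i\<le>card (B - A). real (card (X i)) / real (card (B - A) choose i)) \<le> real m"
    using False assms(4) card_interval_level_le[OF assms(1), of F A]
    by (intro profile_le_of_total) (auto simp: X_def)
  then show ?thesis using lubell_eq_profile[OF assms(1,2), of F] by (simp add: X_def)
qed

section \<open>Intervals with few sets on every inner level\<close>

text \<open>The ends give at most \<open>1\<close> each, levels \<open>1\<close> and
  \<open>k - 1\<close> at most \<open>3 / k\<close>, the others at most
  \<open>3 / (k choose 2)\<close>. For \<open>k = 4\<close> this adds up to exactly
  \<open>4\<close>.\<close>

lemma profile_le_4:
  assumes x: "\<And>i. x i \<le> k choose i" and 3: "\<And>i. 0 < i \<Longrightarrow> i < k \<Longrightarrow> x i < 4"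
  shows "(\<Sum>i\<le>k. real (x i) / real (k choose i)) \<le> 4"
proof (cases "k < 4")
  case True
  then show ?thesis using profile_le_height[of x k, OF x] by linarith
next
  case False
  let ?y = "\<lambda>i. real (x i) / real (k choose i)"
  have y: "?y i \<le> 3 / c" if "0 < i" "i < k" "0 < c" "c \<le> real (k choose i)" for i c
    using 3[OF that(1,2)] that(3,4) by (intro frac_le) auto
  obtain l where l: "k = l + 4" using False by (metis add.commute le_Suc_ex not_less)
  have "{..k} = insert 0 (insert 1 (insert (k - 1) (insert k {2..k - 2})))" using False by auto
  then have "(\<Sum>i\<le>k. ?y i) = (\<Sum>i\<in>insert 0 (insert 1 (insert (k - 1) (insert k {2..k - 2}))). ?y i)"
    by (simp only:)
  also have "\<dots> = ?y 0 + ?y k + (?y 1 + ?y (k - 1) + (\<Sum>i\<in>{2..k - 2}. ?y i))"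
    by (simp add: l)
  also have "?y 0 \<le> 1" by (rule profile_term_le_1[OF x])
  also have "?y k \<le> 1" by (rule profile_term_le_1[OF x])
  also have "?y 1 \<le> 3 / real k" by (rule y) (use False in auto)
  also have "?y (k - 1) \<le> 3 / real k"
    by (rule y) (use False binomial_symmetric[of 1 k] in auto)
  also have "(\<Sum>i\<in>{2..k - 2}. ?y i) \<le> real (card {2..k - 2}) * (3 / (real k * (real k - 1) / 2))"
  proof (rule sum_bounded_above)
    fix i assume i: "i \<in> {2..k - 2}"
    have "k choose 2 \<le> k choose i" by (rule binomial_ge_of_sides) (use i False in auto)
    moreover have "real (k choose 2) = real k * (real k - 1) / 2"
    proof -
      have "2 * (k choose 2) = k * (k - 1)" using times_binomial_minus1_eq[of 2 k] by simp
      then have "real (2 * (k choose 2)) = real (k * (k - 1))" by (rule arg_cong)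
      then show ?thesis using False by (simp add: of_nat_diff)
    qed
    ultimately show "?y i \<le> 3 / (real k * (real k - 1) / 2)"
      using i False by (intro y) auto
  qed
  also have "real (card {2..k - 2}) = real k - 3" using False by (simp add: of_nat_diff)
  finally have "(\<Sum>i\<le>k. ?y i) \<le> 1 + 1 + (3 / real k + 3 / real k + (real k - 3) * (3 / (real k * (real k - 1) / 2)))"
    by simp
  also have "\<dots> \<le> 4"
  proof -
    define r where "r = real k"
    have r: "4 \<le> r" using False by (simp add: r_def)
    \<comment> \<open>After clearing denominators the required bound is equivalent to this.\<close>
    have "0 \<le> (r - 3) * (r - 4)" using r by (intro mult_nonneg_nonneg) auto
    moreover have p: "r * (r - 1) > 0" using r by (intro mult_pos_pos) auto
    ultimately have "(12 * r - 24) / (r * (r - 1)) \<le> 2"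
      by (simp only: pos_divide_le_eq) (simp add: algebra_simps)
    moreover have "3 / r + 3 / r + (r - 3) * (3 / (r * (r - 1) / 2)) = (12 * r - 24) / (r * (r - 1))"
      using r by (simp add: divide_simps)
    ultimately show ?thesis by (simp add: r_def)
  qed
  finally show ?thesis .
qed

text \<open>Central coefficients at least double at each step, since
  \<open>(2 * Suc i) choose Suc i\<close> is twice \<open>(2 * i + 1) choose i\<close>.\<close>

lemma central_binomial_doubles:
  assumes "m \<le> 2 * h + 1"
  shows "2 ^ Suc d * (m choose h) \<le> (2 * (h + Suc d)) choose (h + Suc d)"
proof (induction d)
  have double: "(2 * Suc i) choose Suc i = 2 * ((2 * i + 1) choose i)" for i
    using binomial_symmetric[of i "2 * i + 1"] by simp
  case 0
  have "m choose h \<le> (2 * h + 1) choose h" using assms by (rule binomial_right_mono)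
  then show ?case using double[of h] by simp
next
  have double: "(2 * Suc i) choose Suc i = 2 * ((2 * i + 1) choose i)" for i
    using binomial_symmetric[of i "2 * i + 1"] by simp
  case (Suc d)
  have "(2 * (h + Suc d)) choose (h + Suc d) \<le> (2 * (h + Suc d) + 1) choose (h + Suc d)"
    by (rule binomial_right_mono) simp
  then show ?case using Suc double[of "h + Suc d"] by simp
qed

text \<open>Within \<open>K\<close> steps below the middle, neighbouring coefficients differ at most
  by the displayed factor, which tends to \<open>1\<close> for fixed \<open>K\<close>.\<close>

lemma central_binomial_le_near:
  assumes "d \<le> K" "K \<le> h" "h = m div 2"
  shows "real (m choose h) \<le> ((real h + 1 + real K) / (real h + 1 - real K)) ^ d * real (m choose (h - d))"
  using assms(1)
proof (induction d)
  case (Suc d)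
  let ?r = "(real h + 1 + real K) / (real h + 1 - real K)"
  define i where "i = h - Suc d"
  have i: "Suc i = h - d" "i < m" using Suc(2) assms by (auto simp: i_def)
  have p: "real h + 1 - real K > 0" using assms(2) by simp
  have r0: "?r \<ge> 0" using p by simp
  have "real (m choose Suc i) * real (Suc i) = real (m choose i) * real (m - i)"
    using binomial_step[OF i(2)] by (simp add: mult.commute)
  also have "\<dots> \<le> real (m choose i) * (?r * real (Suc i))"
  proof (rule mult_left_mono)
    have "real h + 1 - real K \<le> real (Suc i)" using Suc(2) assms by (auto simp: i_def)
    then have "?r * (real h + 1 - real K) \<le> ?r * real (Suc i)" using r0 by (rule mult_left_mono)
    moreover have "real (m - i) \<le> real h + 1 + real K" using Suc(2) assms by (auto simp: i_def)
    ultimately show "real (m - i) \<le> ?r * real (Suc i)" using p by simp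
  qed simp
  finally have "real (m choose Suc i) * real (Suc i) \<le> (?r * real (m choose i)) * real (Suc i)"
    by (simp only: mult_ac)
  then have "real (m choose Suc i) \<le> ?r * real (m choose i)"
    by (rule mult_right_le_imp_le) simp
  then have "?r ^ d * real (m choose Suc i) \<le> ?r ^ d * (?r * real (m choose i))"
    using r0 by (intro mult_left_mono) auto
  moreover have "real (m choose h) \<le> ?r ^ d * real (m choose Suc i)" using Suc i by simp
  ultimately show ?case unfolding i_def[symmetric] power_Suc by (simp only: mult_ac)
qed simp

text \<open>For large \<open>m\<close>, each of the \<open>K\<close> levels below the middle \<open>h\<close> saves about \<open>(1 - c) / 2\<close> on either
  side, and the levels beyond \<open>h\<close>, present when \<open>k > m\<close>, contribute a geometric series only.\<close>

lemma profile_le_of_small_levels: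
  fixes c :: real
  assumes c: "1 / 2 < c" "c < 1"
  shows "\<exists>M. \<forall>m\<ge>M. \<forall>k x. (\<forall>i. x i \<le> k choose i) \<longrightarrow>
     (\<forall>i. 0 < i \<longrightarrow> i < k \<longrightarrow> real (x i) \<le> c * real (m choose (m div 2))) \<longrightarrow>
     (\<Sum>i\<le>k. real (x i) / real (k choose i)) \<le> real m"
proof -
  \<comment> \<open>The final count is \<open>2 * h + 4 - K * (1 - c)\<close>, so
    \<open>K * (1 - c) \<ge> 4\<close> brings it down to \<open>2 * h \<le> m\<close>.\<close>
  define K where "K = nat \<lceil>4 / (1 - c)\<rceil>"
  have K: "4 \<le> real K * (1 - c)"
  proof -
    have "4 / (1 - c) \<le> real K" unfolding K_def by linarith
    then show ?thesis using c by (simp add: field_simps)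
  qed
  have "(\<lambda>h::nat. (real h + 1 + real K) / (real h + 1 - real K)) \<longlonglongrightarrow> 1"
    by real_asymp
  then have "(\<lambda>h::nat. ((real h + 1 + real K) / (real h + 1 - real K)) ^ K) \<longlonglongrightarrow> 1 ^ K"
    by (rule tendsto_power)
  \<comment> \<open>Chosen so that \<open>c\<close> times this factor is \<open>(1 + c) / 2\<close>,
    still below \<open>1\<close>.\<close>
  moreover have "1 ^ K < (1 + c) / (2 * c)" using c by simp
  ultimately have "eventually (\<lambda>h. ((real h + 1 + real K) / (real h + 1 - real K)) ^ K < (1 + c) / (2 * c)) sequentially"
    by (rule order_tendstoD(2))
  then obtain H where H: "\<And>h. h \<ge> H \<Longrightarrow> ((real h + 1 + real K) / (real h + 1 - real K)) ^ K < (1 + c) / (2 * c)"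
    unfolding eventually_sequentially by blast
  have "(\<Sum>i\<le>k. real (x i) / real (k choose i)) \<le> real m"
    if m: "m \<ge> 2 * max H K + 1" and x: "\<forall>i. x i \<le> k choose i"
      and xc: "\<forall>i. 0 < i \<longrightarrow> i < k \<longrightarrow> real (x i) \<le> c * real (m choose (m div 2))" for m k x
  proof (cases "k < m")
    case True
    then show ?thesis using profile_le_height[of x k] x by fastforce
  next
    case False
    define h where "h = m div 2"
    have h: "h \<ge> H" "h \<ge> K" "m \<le> 2 * h + 1" "2 * h \<le> m" using m by (auto simp: h_def)
    define z where "z i = (if i + K \<le> h then 1 else if i \<le> h then (1 + c) / 2 else (1/2) ^ (i - h))" for i
    have z0: "0 \<le> z i" for i using c by (simp add: z_def)
    \<comment> \<open>Stated for a number \<open>w\<close> so that it applies to level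
      \<open>i\<close> and, by reflection, to levels in the upper half.\<close>
    have key: "real w / real (k choose i) \<le> z i"
      if i: "2 * i \<le> k" and w: "w \<le> k choose i" "0 < i \<Longrightarrow> i < k \<Longrightarrow> real w \<le> c * real (m choose h)" for i w
    proof -
      have kp: "real (k choose i) > 0" using i by simp
      consider "i + K \<le> h" | "h < i + K" "i \<le> h" | "h < i" by linarith
      then show ?thesis
      proof cases
        case 1
        then show ?thesis using profile_term_le_1[OF w(1)] by (simp add: z_def)
      next
        case 2
        let ?r = "(real h + 1 + real K) / (real h + 1 - real K)"
        have r1: "1 \<le> ?r" using h by (simp add: field_simps)
        have "0 < i" "i < k" using 2 h i False by auto
        then have "real w \<le> c * real (m choose h)" by (rule w(2))
        also have "real (m choose h) \<le> ?r ^ (h - i) * real (m choose (h - (h - i)))"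
          using 2 h by (intro central_binomial_le_near) (auto simp: h_def)
        also have "?r ^ (h - i) * real (m choose (h - (h - i))) \<le> ?r ^ K * real (k choose i)"
          using 2 r1 False by (intro mult_mono power_increasing) (auto intro!: binomial_right_mono)
        also have "\<dots> \<le> (1 + c) / (2 * c) * real (k choose i)"
          using H[OF h(1)] by (intro mult_right_mono) auto
        finally have "real w \<le> c * ((1 + c) / (2 * c) * real (k choose i))"
          using c by simp
        also have "\<dots> = (1 + c) / 2 * real (k choose i)" using c by simp
        finally show ?thesis using kp 2 by (simp add: z_def pos_divide_le_eq)
      next
        case 3
        have ik: "0 < i" "i < k" using 3 i by auto
        define d where "d = i - h - 1"
        have d: "i = h + Suc d" using 3 by (simp add: d_def)
        have "real w \<le> c * real (m choose h)" using ik by (rule w(2))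
        also have "\<dots> \<le> real (m choose h)" using c by (simp add: mult_left_le_one_le)
        finally have "2 ^ Suc d * real w \<le> real (2 ^ Suc d * (m choose h))" by simp
        also have "2 ^ Suc d * (m choose h) \<le> k choose i"
          using central_binomial_doubles[OF h(3), of d] binomial_right_mono[OF i, of i] d by simp
        finally have "2 ^ Suc d * real w \<le> real (k choose i)" by simp
        then show ?thesis using kp 3 d by (simp add: z_def field_simps power_one_over)
      qed
    qed
    have level_bound: "real (x i) / real (k choose i) \<le> z i + z (k - i)" if "i \<le> k" for i
    proof (cases "2 * i \<le> k")
      case True
      have "real (x i) / real (k choose i) \<le> z i" using True x xc by (intro key) (auto simp: h_def)
      then show ?thesis using z0[of "k - i"] by simp
    next
      case False
      have "real (x i) / real (k choose (k - i)) \<le> z (k - i)"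
      proof (rule key)
        show "x i \<le> k choose (k - i)" using x by (simp flip: binomial_symmetric[OF that])
      qed (use False xc that in \<open>auto simp: h_def\<close>)
      then show ?thesis using z0[of i] binomial_symmetric[OF that] by simp
    qed
    have "(\<Sum>i\<le>k. real (x i) / real (k choose i)) \<le> (\<Sum>i\<le>k. z i + z (k - i))"
      by (intro sum_mono level_bound) simp
    also have "\<dots> = 2 * (\<Sum>i\<le>k. z i)"
    proof -
      have "(\<Sum>i\<le>k. z (k - i)) = (\<Sum>i\<le>k. z i)"
        by (rule sum.reindex_bij_witness[of _ "\<lambda>i. k - i" "\<lambda>i. k - i"]) auto
      then show ?thesis by (simp add: sum.distrib)
    qed
    also have "(\<Sum>i\<le>k. z i) \<le> (\<Sum>i\<in>{..h - K} \<union> {h - K<..h} \<union> {h<..h + k}. z i)"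
      using z0 by (intro sum_mono2) auto
    also have "\<dots> = (\<Sum>i\<le>h - K. z i) + (\<Sum>i\<in>{h - K<..h}. z i) + (\<Sum>i\<in>{h<..h + k}. z i)"
      by (subst sum.union_disjoint; (subst sum.union_disjoint)?) auto
    also have "(\<Sum>i\<le>h - K. z i) = (\<Sum>i\<le>h - K. 1)"
      by (rule sum.cong) (use h in \<open>auto simp: z_def\<close>)
    also have "\<dots> = real h - real K + 1" using h by (simp add: of_nat_diff)
    also have "(\<Sum>i\<in>{h - K<..h}. z i) = (\<Sum>i\<in>{h - K<..h}. (1 + c) / 2)"
      by (rule sum.cong) (auto simp: z_def)
    also have "\<dots> = real K * ((1 + c) / 2)" using h by simp
    also have "(\<Sum>i\<in>{h<..h + k}. z i) = (\<Sum>j<k. (1/2) ^ Suc j)"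
      by (rule sum.reindex_bij_witness[of _ "\<lambda>j. h + Suc j" "\<lambda>i. i - h - 1"])
        (auto simp: z_def Suc_diff_Suc simp flip: power_Suc)
    also have "\<dots> \<le> 1"
    proof -
      have "(\<Sum>j<k. (1/2::real) ^ Suc j) = 1 - (1/2) ^ k" by (induction k) auto
      then show ?thesis by simp
    qed
    finally have "(\<Sum>i\<le>k. real (x i) / real (k choose i))
       \<le> 2 * (real h - real K + 1 + real K * ((1 + c) / 2) + 1)" by simp
    also have "\<dots> = 2 * real h + 4 - real K * (1 - c)" by (simp add: algebra_simps)
    also have "\<dots> \<le> real m" using K h(4) by linarith
    finally show ?thesis .
  qed
  then show ?thesis by blast
qed

section \<open>Assembly of the three statements\<close>

lemma supersaturation_diamond:
  assumes s: "2 \<le> s" "int s \<le> 2 ^ m - int (m choose ((m + 1) div 2)) - 1" and "\<epsilon> > 0"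
  shows "\<exists>\<delta>::real. \<delta> > 0 \<and> (\<forall>n (F :: nat set set). F \<subseteq> Pow {1..n} \<and>
      real (card F) \<ge> (real m + \<epsilon>) * real (n choose (n div 2)) \<longrightarrow>
      real (card (copies (diamond s) (diamond_order s) F)) \<ge> \<delta> * real n powr (real m - 0.5) * real (n choose (n div 2)))"
proof (rule supersaturation_copies)
  \<comment> \<open>At most \<open>s - 1\<close> interior sets, two ends and one middle level fit
    into \<open>2 ^ m\<close>; this is the room that \<open>lubell_le_of_interior\<close> asks
    for.\<close>
  have "int (s + 1 + (m choose ((m + 1) div 2))) \<le> int (2 ^ m)" using s(2) by simp
  then have le: "s + 1 + (m choose ((m + 1) div 2)) \<le> 2 ^ m" by (simp only: of_nat_le_iff)
  show "1 \<le> m" using le s(1) by (cases "m = 0") auto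
  show "lubell (\<lambda>S. of_bool (S \<in> F)) A B \<le> real m"
    if "finite B" "A \<subseteq> B" "card {S \<in> F. A \<subset> S \<and> S \<subset> B} < s" for F and A B :: "nat set"
    using that le by (rule lubell_le_of_interior)
qed (use assms in auto)

theorem theorem1p8:
  "(\<forall>s::nat. 2 \<le> s \<and>
        int s \<in> {2 ^ (m_diamond s - 1) - 1 ..
          2 ^ m_diamond s - int (m_diamond s choose ((m_diamond s + 1) div 2)) - 1} \<longrightarrow>
      (\<forall>\<epsilon>::real. \<epsilon> > 0 \<longrightarrow> (\<exists>\<delta>::real. \<delta> > 0 \<and>
        (\<forall>(n::nat) (F::nat set set). F \<subseteq> Pow {1..n} \<and>
            real (card F) \<ge> (real (m_diamond s) + \<epsilon>) * real (n choose (n div 2)) \<longrightarrow>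
          real (card (copies (diamond s) (diamond_order s) F))
            \<ge> \<delta> * real n powr (real (m_diamond s) - 0.5) * real (n choose (n div 2))))))
   \<and> (\<forall>\<epsilon>::real. \<epsilon> > 0 \<longrightarrow> (\<exists>\<delta>::real. \<delta> > 0 \<and>
        (\<forall>(n::nat) (F::nat set set). F \<subseteq> Pow {1..n} \<and>
            real (card F) \<ge> (4 + \<epsilon>) * real (n choose (n div 2)) \<longrightarrow>
          real (card (induced_copies (diamond 4) (diamond_order 4) F))
            \<ge> \<delta> * real n powr 3.5 * real (n choose (n div 2)))))
   \<and> (\<forall>c::real. 1/2 < c \<and> c < 1 \<longrightarrow> (\<exists>s\<^sub>c::nat. \<forall>s::nat. 2 \<le> s \<and> s \<ge> s\<^sub>c \<and>
        real s \<le> c * real (m_star s choose (m_star s div 2)) \<longrightarrow>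
      (\<forall>\<epsilon>::real. \<epsilon> > 0 \<longrightarrow> (\<exists>\<delta>::real. \<delta> > 0 \<and>
        (\<forall>(n::nat) (F::nat set set). F \<subseteq> Pow {1..n} \<and>
            real (card F) \<ge> (real (m_star s) + \<epsilon>) * real (n choose (n div 2)) \<longrightarrow>
          real (card (induced_copies (diamond s) (diamond_order s) F))
            \<ge> \<delta> * real n powr (real (m_star s) - 0.5) * real (n choose (n div 2)))))))"
proof (intro conjI allI impI)
  fix s :: nat and \<epsilon> :: real
  assume "2 \<le> s \<and> int s \<in> {2 ^ (m_diamond s - 1) - 1 ..
          2 ^ m_diamond s - int (m_diamond s choose ((m_diamond s + 1) div 2)) - 1}" and "\<epsilon> > 0"
  then show "\<exists>\<delta>::real. \<delta> > 0 \<and>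
        (\<forall>(n::nat) (F::nat set set). F \<subseteq> Pow {1..n} \<and>
            real (card F) \<ge> (real (m_diamond s) + \<epsilon>) * real (n choose (n div 2)) \<longrightarrow>
          real (card (copies (diamond s) (diamond_order s) F))
            \<ge> \<delta> * real n powr (real (m_diamond s) - 0.5) * real (n choose (n div 2)))"
    by (intro supersaturation_diamond) auto
next
  fix \<epsilon> :: real
  assume "\<epsilon> > 0"
  then have "\<exists>\<delta>::real. \<delta> > 0 \<and> (\<forall>n (F :: nat set set). F \<subseteq> Pow {1..n} \<and>
      real (card F) \<ge> (real 4 + \<epsilon>) * real (n choose (n div 2)) \<longrightarrow>
      real (card (induced_copies (diamond 4) (diamond_order 4) F)) \<ge> \<delta> * real n powr (real 4 - 0.5) * real (n choose (n div 2)))"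
    by (intro supersaturation_induced_copies) (auto intro: profile_le_4)
  then show "\<exists>\<delta>::real. \<delta> > 0 \<and>
        (\<forall>(n::nat) (F::nat set set). F \<subseteq> Pow {1..n} \<and>
            real (card F) \<ge> (4 + \<epsilon>) * real (n choose (n div 2)) \<longrightarrow>
          real (card (induced_copies (diamond 4) (diamond_order 4) F))
            \<ge> \<delta> * real n powr 3.5 * real (n choose (n div 2)))"
    by simp
next
  fix c :: real
  assume c: "1/2 < c \<and> c < 1"
  then have "1/2 < c" "c < 1" by simp_all
  from profile_le_of_small_levels[OF this] obtain M where M: "\<forall>m\<ge>M. \<forall>k x.
     (\<forall>i. x i \<le> k choose i) \<longrightarrow>
     (\<forall>i. 0 < i \<longrightarrow> i < k \<longrightarrow> real (x i) \<le> c * real (m choose (m div 2))) \<longrightarrow>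
     (\<Sum>i\<le>k. real (x i) / real (k choose i)) \<le> real m"
    by (elim exE)
  have main: "\<exists>\<delta>::real. \<delta> > 0 \<and>
        (\<forall>(n::nat) (F::nat set set). F \<subseteq> Pow {1..n} \<and>
            real (card F) \<ge> (real m + \<epsilon>) * real (n choose (n div 2)) \<longrightarrow>
          real (card (induced_copies (diamond s) (diamond_order s) F))
            \<ge> \<delta> * real n powr (real m - 0.5) * real (n choose (n div 2)))"
    if s: "2 \<le> s \<and> s \<ge> 2 ^ Suc M \<and> real s \<le> c * real (m choose (m div 2))" and "\<epsilon> > 0" for s m :: nat and \<epsilon> :: real
  proof (rule supersaturation_induced_copies)
    have "c * real (m choose (m div 2)) \<le> real (m choose (m div 2))"
      using c by (simp add: mult_left_le_one_le)
    then have "s \<le> m choose (m div 2)" using s by linarith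
    \<comment> \<open>The threshold on \<open>s\<close> is chosen for this: a coefficient of row
      \<open>m\<close> is at most \<open>2 ^ m\<close>, which forces \<open>m > M\<close>.\<close>
    then have "2 ^ Suc M \<le> (2::nat) ^ m" using s binomial_le_pow2[of m "m div 2"] by linarith
    then have mM: "Suc M \<le> m" by (simp only: power_increasing_iff one_less_numeral_iff semiring_norm(76))
    then show "1 \<le> m" by simp
    show "(\<Sum>i\<le>k. real (x i) / real (k choose i)) \<le> real m"
      if "\<And>i. x i \<le> k choose i" "\<And>i. 0 < i \<Longrightarrow> i < k \<Longrightarrow> x i < s" for k x
    proof (rule M[rule_format])
      show "real (x i) \<le> c * real (m choose (m div 2))" if "0 < i" "i < k" for i
        using \<open>\<And>i. 0 < i \<Longrightarrow> i < k \<Longrightarrow> x i < s\<close>[OF that] s by linarith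
    qed (use that mM in auto)
  qed (use that in auto)
  show "\<exists>s\<^sub>c::nat. \<forall>s::nat. 2 \<le> s \<and> s \<ge> s\<^sub>c \<and>
        real s \<le> c * real (m_star s choose (m_star s div 2)) \<longrightarrow>
      (\<forall>\<epsilon>::real. \<epsilon> > 0 \<longrightarrow> (\<exists>\<delta>::real. \<delta> > 0 \<and>
        (\<forall>(n::nat) (F::nat set set). F \<subseteq> Pow {1..n} \<and>
            real (card F) \<ge> (real (m_star s) + \<epsilon>) * real (n choose (n div 2)) \<longrightarrow>
          real (card (induced_copies (diamond s) (diamond_order s) F))
            \<ge> \<delta> * real n powr (real (m_star s) - 0.5) * real (n choose (n div 2)))))"
    by (intro exI[of _ "2 ^ Suc M"] allI impI main)
qed

end
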